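(* Let $Z=N\times[0,\infty)$, where $N$ is a compact (closed) Riemannian surface with metric $g_N$, be endowed with a metric of the form $$g=dr^2+\phi(\omega,r)^2g_N,\qquad \omega\in N,\ r\in[0,\infty),$$ with $\phi$ a smooth positive function. Assume that there are a differentiable function $\overline{\phi}>0$ on $[0,\infty)$ that depends only on $r$, and $r_0>0$, such that $$\overline{\phi}(r)\le\phi(\omega,r)\qquad\text{and}\qquad 0<\frac{\overline{\phi}_r}{\overline{\phi}}(r)\le\frac{\phi_r}{\phi}(\omega,r)$$ for all $r\ge r_0$ and all $\omega\in N$, and also that $$\int_0^\infty\frac{1}{\overline{\phi}}\,dr<\infty .$$ Then every point $(z,\infty)\in N\times\{\infty\}$ is a regular boundary point.
   Context: Subscripts $r$ denote derivatives in $r$. Let $\overline{Z}=N\times[0,\infty]$ with the product topology, where $[0,\infty]$ is the compactification of $[0,\infty)$ by one point $\infty$. A continuous function $v$ is superharmonic on $N\times(0,\infty)$ if for every relatively compact open set $\Omega$ with $\overline{\Omega}\subset N\times(0,\infty)$ and every continuous function $h$ on $\overline{\Omega}$ that is harmonic in $\Omega$ (i.e. $C^2$ with $\Delta_g h=0$, where $\Delta_g$ is the Laplace-Beltrami operator of $g$) and satisfies $h=v$ on $\partial\Omega$, one has $h\le v$ in $\Omega$. A barrier at a point $(p,\infty)\in N\times\{\infty\}$ is a nonnegative continuous function $b:\overline{Z}\to\mathbb{R}$, superharmonic on $N\times(0,\infty)$, such that $b(p,\infty)=0$ and $b>0$ on $\overline{Z}\setminus\{(p,\infty)\}$. A point $(p,\infty)$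 at which a barrier exists is called a regular boundary point. *)

theory Defs
  imports "HOL-Analysis.Analysis"
begin

text \<open>\<open>k\<close> times continuously differentiable; meant for open \<open>S\<close>.\<close>

fun Ck_on :: "nat \<Rightarrow> 'a::euclidean_space set \<Rightarrow> ('a \<Rightarrow> 'b::real_normed_vector) \<Rightarrow> bool" where
  "Ck_on 0 S f \<longleftrightarrow> continuous_on S f"
| "Ck_on (Suc k) S f \<longleftrightarrow>
     (\<forall>x\<in>S. f differentiable (at x)) \<and>
     (\<forall>e\<in>Basis. Ck_on k S (\<lambda>x. frechet_derivative f (at x) e))"

text \<open>On a set that is not open, such as \<open>V \<times> {0..}\<close>, smoothness means that \<open>f\<close> extends
  smoothly to a neighbourhood of each point.\<close>

definition smooth_on :: "'a::euclidean_space set \<Rightarrow> ('a \<Rightarrow> 'b::real_normed_vector) \<Rightarrow> bool" where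
  "smooth_on S f \<longleftrightarrow>
     (\<forall>x\<in>S. \<exists>W F. open W \<and> x \<in> W \<and> (\<forall>k. Ck_on k W F) \<and> (\<forall>y\<in>S \<inter> W. F y = f y))"

definition partial :: "'n \<Rightarrow> (real^'n \<Rightarrow> real) \<Rightarrow> real^'n \<Rightarrow> real" where
  "partial i f u = frechet_derivative f (at u) (axis i 1)"

text \<open>A manifold is presented by an indexed atlas: \<open>chart M i\<close> maps the open set
  \<open>chart_dom M i\<close> homeomorphically onto an open subset of \<open>\<real>\<^sup>n\<close>.  A metric is given by its
  component matrices \<open>metric M i u\<close> at the point with coordinates \<open>u\<close> in chart \<open>i\<close>.\<close>

record ('a, 'i, 'n) riem =
  pts :: "'a topology"
  idx :: "'i set"
  chart_dom :: "'i \<Rightarrow> 'a set"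
  chart :: "'i \<Rightarrow> 'a \<Rightarrow> real^'n"
  metric :: "'i \<Rightarrow> real^'n \<Rightarrow> real^'n^'n"

definition chart_inv :: "('a, 'i, 'n::finite) riem \<Rightarrow> 'i \<Rightarrow> real^'n \<Rightarrow> 'a" where
  "chart_inv M i = inv_into (chart_dom M i) (chart M i)"

definition smooth_manifold :: "('a, 'i, 'n::finite) riem \<Rightarrow> bool" where
  "smooth_manifold M \<longleftrightarrow>
     Hausdorff_space (pts M) \<and> second_countable (pts M) \<and>
     (\<Union>i\<in>idx M. chart_dom M i) = topspace (pts M) \<and>
     (\<forall>i\<in>idx M. openin (pts M) (chart_dom M i) \<and> open (chart M i ` chart_dom M i) \<and>
        homeomorphic_map (subtopology (pts M) (chart_dom M i))
          (top_of_set (chart M i ` chart_dom M i)) (chart M i)) \<and>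
     (\<forall>i\<in>idx M. \<forall>j\<in>idx M.
        smooth_on (chart M i ` (chart_dom M i \<inter> chart_dom M j)) (chart M j \<circ> chart_inv M i))"

text \<open>The last condition is the transformation law of a covariant 2-tensor, with \<open>J\<close> the
  Jacobian matrix of the change of coordinates.\<close>

definition riemannian_manifold :: "('a, 'i, 'n::finite) riem \<Rightarrow> bool" where
  "riemannian_manifold M \<longleftrightarrow>
     smooth_manifold M \<and>
     (\<forall>i\<in>idx M. smooth_on (chart M i ` chart_dom M i) (metric M i)) \<and>
     (\<forall>i\<in>idx M. \<forall>u\<in>chart M i ` chart_dom M i.
        transpose (metric M i u) = metric M i u \<and>
        (\<forall>w. w \<noteq> 0 \<longrightarrow> 0 < w \<bullet> (metric M i u *v w))) \<and>
     (\<forall>i\<in>idx M. \<forall>j\<in>idx M. \<forall>u\<in>chart M i ` (chart_dom M i \<inter> chart_dom M j).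
        let T = chart M j \<circ> chart_inv M i; J = matrix (frechet_derivative T (at u))
        in metric M i u = transpose J ** metric M j (T u) ** J)"

text \<open>The Laplace-Beltrami operator in coordinates:
  \<open>(det G)\<^sup>-\<^sup>1\<^sup>/\<^sup>2 \<Sum>\<^sub>i\<^sub>j \<partial>\<^sub>i ((det G)\<^sup>1\<^sup>/\<^sup>2 G\<^sup>i\<^sup>j \<partial>\<^sub>j f)\<close>, where \<open>G\<^sup>i\<^sup>j\<close> are the entries of the inverse
  matrix.\<close>

definition laplace_beltrami ::
    "(real^'n \<Rightarrow> real^'n^'n) \<Rightarrow> (real^'n \<Rightarrow> real) \<Rightarrow> real^'n \<Rightarrow> real" where
  "laplace_beltrami G f u =
     (\<Sum>i\<in>UNIV. \<Sum>j\<in>UNIV.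
        partial i (\<lambda>v. sqrt (det (G v)) * matrix_inv (G v) $ i $ j * partial j f v) u)
     / sqrt (det (G u))"

definition harmonic_on :: "('a, 'i, 'n::finite) riem \<Rightarrow> 'a set \<Rightarrow> ('a \<Rightarrow> real) \<Rightarrow> bool" where
  "harmonic_on M \<Omega> h \<longleftrightarrow>
     (\<forall>i\<in>idx M. let V = chart M i ` (chart_dom M i \<inter> \<Omega>); f = h \<circ> chart_inv M i
        in Ck_on 2 V f \<and> (\<forall>u\<in>V. laplace_beltrami (metric M i) f u = 0))"

text \<open>\<open>\<Omega>\<close> is relatively compact in \<open>M\<close>: its closure in \<open>M\<close> is compact.\<close>

definition superharmonic :: "('a, 'i, 'n::finite) riem \<Rightarrow> ('a \<Rightarrow> real) \<Rightarrow> bool" where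
  "superharmonic M v \<longleftrightarrow>
     continuous_map (pts M) euclideanreal v \<and>
     (\<forall>\<Omega> h. openin (pts M) \<Omega> \<and> compactin (pts M) (pts M closure_of \<Omega>) \<and>
        continuous_map (subtopology (pts M) (pts M closure_of \<Omega>)) euclideanreal h \<and>
        harmonic_on M \<Omega> h \<and> (\<forall>z\<in>pts M frontier_of \<Omega>. h z = v z)
        \<longrightarrow> (\<forall>z\<in>\<Omega>. h z \<le> v z))"

text \<open>Smoothness of \<open>\<phi>\<close> up to and including the boundary \<open>r = 0\<close>.\<close>

definition smooth_on_half_cylinder ::
    "('a, 'i, 'n::finite) riem \<Rightarrow> ('a \<Rightarrow> real \<Rightarrow> real) \<Rightarrow> bool" where
  "smooth_on_half_cylinder N \<phi> \<longleftrightarrow>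
     (\<forall>i\<in>idx N. smooth_on ((chart N i ` chart_dom N i) \<times> {0..})
        (\<lambda>(u, r). \<phi> (chart_inv N i u) r))"

text \<open>The Riemannian manifold \<open>N \<times> (0,\<infinity>)\<close> with metric \<open>dr\<^sup>2 + \<phi>(\<omega>,r)\<^sup>2 g\<^sub>N\<close>, in the charts
  \<open>(\<omega>, r) \<mapsto> (x\<^sub>1(\<omega>), x\<^sub>2(\<omega>), r)\<close>, one for each chart \<open>x\<close> of the surface \<open>N\<close>.\<close>

definition warped_cylinder ::
    "('a, 'i, 2) riem \<Rightarrow> ('a \<Rightarrow> real \<Rightarrow> real) \<Rightarrow> ('a \<times> real, 'i, 3) riem" where
  "warped_cylinder N \<phi> =
     \<lparr> pts = prod_topology (pts N) (top_of_set {0<..}),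
       idx = idx N,
       chart_dom = (\<lambda>i. chart_dom N i \<times> {0<..}),
       chart = (\<lambda>i (\<omega>, r). vector [chart N i \<omega> $ 1, chart N i \<omega> $ 2, r]),
       metric = (\<lambda>i u.
         let x = vector [u $ 1, u $ 2]; r = u $ 3;
             c = (\<phi> (chart_inv N i x) r)\<^sup>2; g = metric N i x
         in vector [vector [c * g $ 1 $ 1, c * g $ 1 $ 2, 0],
                    vector [c * g $ 2 $ 1, c * g $ 2 $ 2, 0],
                    vector [0, 0, 1]]) \<rparr>"

text \<open>The compactified half-line \<open>[0,\<infinity>]\<close> is the type of extended nonnegative reals.\<close>

definition compactified :: "('a, 'i, 2) riem \<Rightarrow> ('a \<times> ennreal) topology" where
  "compactified N = prod_topology (pts N) euclidean"

definition barrier ::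
    "('a, 'i, 2) riem \<Rightarrow> ('a \<Rightarrow> real \<Rightarrow> real) \<Rightarrow> 'a \<Rightarrow> ('a \<times> ennreal \<Rightarrow> real) \<Rightarrow> bool" where
  "barrier N \<phi> p b \<longleftrightarrow>
     continuous_map (compactified N) euclideanreal b \<and>
     (\<forall>z\<in>topspace (compactified N). 0 \<le> b z) \<and>
     superharmonic (warped_cylinder N \<phi>) (\<lambda>(\<omega>, r). b (\<omega>, ennreal r)) \<and>
     b (p, \<infinity>) = 0 \<and>
     (\<forall>z\<in>topspace (compactified N) - {(p, \<infinity>)}. 0 < b z)"

definition regular_boundary_point ::
    "('a, 'i, 2) riem \<Rightarrow> ('a \<Rightarrow> real \<Rightarrow> real) \<Rightarrow> 'a \<Rightarrow> bool" where
  "regular_boundary_point N \<phi> p \<longleftrightarrow> p \<in> topspace (pts N) \<and> (\<exists>b. barrier N \<phi> p b)"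

end

theory Submission
  imports Defs
begin

text \<open>
  The metric \<open>dr\<^sup>2 + \<phi>\<^sup>2 g\<^sub>N\<close> has determinant \<open>\<phi>\<^sup>4 det g\<^sub>N\<close>, and its inverse scales \<open>g\<^sub>N\<^sup>-\<^sup>1\<close> by
  \<open>\<phi>\<^sup>-\<^sup>2\<close>.  Because \<open>N\<close> is two-dimensional, the two factors cancel in the horizontal coefficients
  of \<open>\<surd>det G G\<^sup>i\<^sup>j\<close>, so that no derivative of \<open>\<phi>\<close> along \<open>N\<close> enters the Laplacian:
  \<open>\<Delta>f = f\<^sub>r\<^sub>r + 2 (\<phi>\<^sub>r/\<phi>) f\<^sub>r + \<phi>\<^sup>-\<^sup>2 \<Delta>\<^sub>N f\<close> (lemma \<open>laplace_beltrami_warped\<close>).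

  Consider \<open>q(\<omega>) + A(r)\<close> with \<open>q\<close> the squared coordinate distance from \<open>z\<close> in a chart and
  \<open>A(r) = C \<integral>\<^sub>r\<^sup>\<infinity> s / \<phi>b(s)\<^sup>2 ds\<close>.  The function \<open>A\<close> solves \<open>A'' + 2 (\<phi>b'/\<phi>b) A' = - C/\<phi>b\<^sup>2\<close>;
  it is finite, and decreases to \<open>0\<close>, because \<open>\<phi>b\<close> is increasing and \<open>1/\<phi>b\<close> is integrable, which
  together bound \<open>s/\<phi>b(s)\<close> (lemma \<open>radial_supersolution_exists\<close>).  As \<open>A' < 0\<close>, the
  comparison of the logarithmic derivatives and \<open>\<phi>b \<le> \<phi>\<close> give
  \<open>A'' + 2 (\<phi>\<^sub>r/\<phi>) A' \<le> - C/\<phi>\<^sup>2\<close>, so \<open>q + A\<close> has negative Laplacian wherever \<open>\<Delta>\<^sub>N q < C\<close>,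
  hence near \<open>z\<close> for a suitable \<open>C\<close>.

  The barrier is the smaller of \<open>min q \<rho>\<^sup>2 + A(r)\<close>, with \<open>\<rho>\<^sup>2\<close> for the minimum off the chart,
  and \<open>B(r) = A(r0) - \<delta> exp(k r)\<close>.  On a bounded range of \<open>r\<close> the quotient \<open>\<phi>\<^sub>r/\<phi>\<close> is bounded below, by compactness and smoothness up to
  \<open>r = 0\<close> (lemma \<open>log_derivative_bounded_below\<close>), so a large \<open>k\<close> makes the Laplacian of \<open>B\<close>
  negative.  The constants \<open>\<delta>\<close> and \<open>\<rho>\<close> are chosen such that \<open>B\<close> is the smaller one for
  \<open>r \<le> r0\<close>, where the differential inequality for \<open>A\<close> is not at hand, and the larger one for
  \<open>r \<ge> r0 + 1\<close>, so that only \<open>min q \<rho>\<^sup>2 + A\<close> matters at infinity.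

  Every point of the cylinder thus has a function \<open>q + a(r)\<close> with negative Laplacian there that
  lies above the barrier nearby and agrees with it at the point.  If a harmonic \<open>h\<close> with the
  boundary values of the barrier exceeded it somewhere, the difference would have an interior
  maximum; there the touching function has at least the Laplacian of \<open>h\<close>, by the second-derivative
  test, contradicting the strict sign (lemma \<open>superharmonicI_touching\<close>).
\<close>

section \<open>Calculus of once and twice differentiable functions\<close>

lemma Ck1_iff:
  "Ck_on (Suc 0) S f \<longleftrightarrow> (\<forall>x\<in>S. f differentiable (at x)) \<and>
     (\<forall>e\<in>Basis. continuous_on S (\<lambda>x. frechet_derivative f (at x) e))"
  by simp

lemma Ck1_imp_continuous_on:
  assumes "Ck_on (Suc 0) S f"
  shows "continuous_on S f"
  using assms
  by (auto simp: Ck1_iff intro!: continuous_at_imp_continuous_on differentiable_imp_continuous_within)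

lemma Ck1_I:
  assumes "\<And>x. x \<in> S \<Longrightarrow> (f has_derivative f' x) (at x)"
    and "\<And>e. e \<in> Basis \<Longrightarrow> continuous_on S (\<lambda>x. f' x e)"
  shows "Ck_on (Suc 0) S f"
proof -
  have "frechet_derivative f (at x) = f' x" if "x \<in> S" for x
    using frechet_derivative_at[OF assms(1)[OF that]] by simp
  then show ?thesis
    using assms by (auto simp: Ck1_iff differentiable_def cong: continuous_on_cong)
qed

lemma Ck1_D:
  assumes "Ck_on (Suc 0) S f" "x \<in> S"
  shows "(f has_derivative frechet_derivative f (at x)) (at x)"
  using assms frechet_derivative_works by (auto simp: Ck1_iff)

lemma Ck1_mult:
  fixes f g :: "'a::euclidean_space \<Rightarrow> real"
  assumes "Ck_on (Suc 0) S f" "Ck_on (Suc 0) S g"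
  shows "Ck_on (Suc 0) S (\<lambda>x. f x * g x)"
proof (rule Ck1_I)
  show "((\<lambda>x. f x * g x) has_derivative (\<lambda>e. f x * frechet_derivative g (at x) e +
      frechet_derivative f (at x) e * g x)) (at x)" if "x \<in> S" for x
    using has_derivative_mult[OF Ck1_D[OF assms(1) that] Ck1_D[OF assms(2) that]] .
  show "continuous_on S (\<lambda>x. f x * frechet_derivative g (at x) e +
      frechet_derivative f (at x) e * g x)" if "e \<in> Basis" for e
    using assms Ck1_imp_continuous_on[OF assms(1)] Ck1_imp_continuous_on[OF assms(2)] that
    by (auto simp: Ck1_iff intro!: continuous_intros)
qed

lemma Ck1_diff:
  fixes f g :: "'a::euclidean_space \<Rightarrow> real"
  assumes "Ck_on (Suc 0) S f" "Ck_on (Suc 0) S g"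
  shows "Ck_on (Suc 0) S (\<lambda>x. f x - g x)"
proof (rule Ck1_I)
  show "((\<lambda>x. f x - g x) has_derivative (\<lambda>e. frechet_derivative f (at x) e -
      frechet_derivative g (at x) e)) (at x)" if "x \<in> S" for x
    using has_derivative_diff[OF Ck1_D[OF assms(1) that] Ck1_D[OF assms(2) that]] .
  show "continuous_on S (\<lambda>x. frechet_derivative f (at x) e - frechet_derivative g (at x) e)"
    if "e \<in> Basis" for e
    using assms that by (auto simp: Ck1_iff intro!: continuous_intros)
qed

lemma Ck1_bounded_linear:
  fixes f :: "'a::euclidean_space \<Rightarrow> 'b::real_normed_vector"
  assumes "bounded_linear L" "Ck_on (Suc 0) S f"
  shows "Ck_on (Suc 0) S (\<lambda>x. L (f x))"
proof (rule Ck1_I)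
  show "((\<lambda>x. L (f x)) has_derivative (\<lambda>e. L (frechet_derivative f (at x) e))) (at x)"
    if "x \<in> S" for x
    using bounded_linear.has_derivative[OF assms(1) Ck1_D[OF assms(2) that]] .
  show "continuous_on S (\<lambda>x. L (frechet_derivative f (at x) e))" if "e \<in> Basis" for e
    using assms(2) that by (auto simp: Ck1_iff intro!: bounded_linear.continuous_on[OF assms(1)])
qed

lemma Ck1_minus:
  fixes f :: "'a::euclidean_space \<Rightarrow> real"
  shows "Ck_on (Suc 0) S f \<Longrightarrow> Ck_on (Suc 0) S (\<lambda>x. - f x)"
  using Ck1_bounded_linear[of uminus S f] bounded_linear_minus[OF bounded_linear_ident] by simp

lemma Ck1_compose:
  fixes f :: "'a::euclidean_space \<Rightarrow> real" and \<psi> \<psi>' :: "real \<Rightarrow> real"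
  assumes "Ck_on (Suc 0) S f"
    and "\<And>x. x \<in> S \<Longrightarrow> (\<psi> has_real_derivative \<psi>' (f x)) (at (f x))"
    and "continuous_on S (\<lambda>x. \<psi>' (f x))"
  shows "Ck_on (Suc 0) S (\<lambda>x. \<psi> (f x))"
proof (rule Ck1_I)
  show "((\<lambda>x. \<psi> (f x)) has_derivative (\<lambda>e. \<psi>' (f x) * frechet_derivative f (at x) e)) (at x)"
    if "x \<in> S" for x
    using has_derivative_compose[OF Ck1_D[OF assms(1) that]
        assms(2)[OF that, unfolded has_field_derivative_def]] .
  show "continuous_on S (\<lambda>x. \<psi>' (f x) * frechet_derivative f (at x) e)" if "e \<in> Basis" for e
    using assms that by (auto simp: Ck1_iff intro!: continuous_intros)
qed

lemma Ck1_cong: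
  assumes "open S" "Ck_on (Suc 0) S f" "\<And>x. x \<in> S \<Longrightarrow> g x = f x"
  shows "Ck_on (Suc 0) S g"
proof (rule Ck1_I)
  show "(g has_derivative frechet_derivative f (at y)) (at y)" if "y \<in> S" for y
    using has_derivative_transform_within_open[OF Ck1_D[OF assms(2) that] assms(1) that, of g] assms(3)
    by simp
  show "continuous_on S (\<lambda>y. frechet_derivative f (at y) e)" if "e \<in> Basis" for e
    using assms(2) that by simp
qed

text \<open>The local extensions in the definition of smoothness agree with \<open>f\<close> near each point of an
  open set, so that they have the same derivatives there.\<close>

lemma smooth_on_open_imp_Ck1:
  assumes S: "open S" and sm: "smooth_on S f"
  shows "Ck_on (Suc 0) S f"
proof -
  have loc: "\<exists>T. open T \<and> x \<in> T \<and> T \<subseteq> S \<and> Ck_on (Suc 0) T f" if x: "x \<in> S" for x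
  proof -
    obtain W F where W: "open W" "x \<in> W" "\<forall>k. Ck_on k W F" "\<forall>y\<in>S \<inter> W. F y = f y"
      using sm x unfolding smooth_on_def by blast
    have o: "open (S \<inter> W)" using S W by blast
    have F1: "Ck_on (Suc 0) W F" using W(3) by blast
    have "Ck_on (Suc 0) (S \<inter> W) f"
    proof (rule Ck1_I)
      show "(f has_derivative frechet_derivative F (at y)) (at y)" if "y \<in> S \<inter> W" for y
        using has_derivative_transform_within_open[OF _ o that, of F "frechet_derivative F (at y)" UNIV f]
          Ck1_D[OF F1, of y] W(4) that by auto
      show "continuous_on (S \<inter> W) (\<lambda>y. frechet_derivative F (at y) e)" if "e \<in> Basis" for e
        using F1 that unfolding Ck1_iff by (meson continuous_on_subset inf_le2)
    qed
    then show ?thesis using o x W(2) by blast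
  qed
  have "f differentiable (at x)" if "x \<in> S" for x
    using loc[OF that] by (auto simp: Ck1_iff)
  moreover have "continuous_on S (\<lambda>x. frechet_derivative f (at x) e)" if e: "e \<in> Basis" for e
  proof (rule continuous_at_imp_continuous_on, safe)
    fix x assume "x \<in> S"
    then obtain T where T: "open T" "x \<in> T" "Ck_on (Suc 0) T f" using loc by blast
    then show "isCont (\<lambda>x. frechet_derivative f (at x) e) x"
      using e by (auto simp: Ck1_iff continuous_on_eq_continuous_at)
  qed
  ultimately show ?thesis by (simp add: Ck1_iff)
qed

lemma partial_eqI:
  assumes "(F has_derivative F') (at u)"
  shows "partial i F u = F' (axis i 1)"
  using frechet_derivative_at[OF assms] by (simp add: partial_def)

lemma frechet_derivative_eq_sum_partial:
  fixes f :: "real^'n \<Rightarrow> real"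
  assumes "f differentiable (at x)"
  shows "frechet_derivative f (at x) d = (\<Sum>i\<in>UNIV. d $ i * partial i f x)"
proof -
  have lin: "linear (frechet_derivative f (at x))"
    using assms linear_frechet_derivative by blast
  have "frechet_derivative f (at x) d =
      frechet_derivative f (at x) (\<Sum>i\<in>UNIV. d $ i *\<^sub>R axis i 1)"
    by (simp add: basis_expansion scalar_mult_eq_scaleR[symmetric])
  also have "\<dots> = (\<Sum>i\<in>UNIV. d $ i * partial i f x)"
    by (simp add: linear_sum[OF lin] linear_scale[OF lin] partial_def)
  finally show ?thesis .
qed

lemma Ck2_D:
  fixes f :: "real^'n \<Rightarrow> real"
  assumes "Ck_on 2 S f"
  shows "x \<in> S \<Longrightarrow> f differentiable (at x)"
    and "Ck_on (Suc 0) S (partial i f)"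
    and "x \<in> S \<Longrightarrow> partial i f differentiable (at x)"
    and "continuous_on S (partial i f)"
    and "continuous_on S (partial j (partial i f))"
proof -
  have f: "\<forall>x\<in>S. f differentiable (at x)" "\<forall>e\<in>Basis. Ck_on (Suc 0) S (\<lambda>x. frechet_derivative f (at x) e)"
    using assms by (simp_all add: numeral_2_eq_2)
  then show "x \<in> S \<Longrightarrow> f differentiable (at x)" by blast
  show *: "Ck_on (Suc 0) S (partial i f)"
    using f(2)[rule_format, of "axis i 1"] unfolding partial_def[abs_def] by simp
  show "x \<in> S \<Longrightarrow> partial i f differentiable (at x)" using * by simp
  show "continuous_on S (partial i f)" using * by (rule Ck1_imp_continuous_on)
  show "continuous_on S (partial j (partial i f))"
    using * unfolding Ck1_iff partial_def[of j, abs_def] by simp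
qed

lemma Ck2_subset:
  assumes "Ck_on 2 S f" "T \<subseteq> S"
  shows "Ck_on 2 T f"
  using assms by (simp add: numeral_2_eq_2) (meson continuous_on_subset subsetD)

lemma Ck2_const: "Ck_on 2 S (\<lambda>_. c)"
  by (simp add: numeral_2_eq_2)

lemma Ck2_I:
  assumes "\<And>x. (f has_derivative f' x) (at x)"
    and "\<And>e. e \<in> Basis \<Longrightarrow> Ck_on (Suc 0) S (\<lambda>x. f' x e)"
  shows "Ck_on 2 S f"
proof -
  have "frechet_derivative f (at x) = f' x" for x
    using frechet_derivative_at[OF assms(1)] by simp
  then show ?thesis
    unfolding numeral_2_eq_2 Ck_on.simps(2)[of "Suc 0"] using assms by (auto simp: differentiable_def)
qed

lemma Ck2_dist_square:
  fixes x0 :: "'a::euclidean_space"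
  shows "Ck_on 2 S (\<lambda>x. (dist x0 x)\<^sup>2)"
proof -
  have 1: "((\<lambda>x. (dist x0 x)\<^sup>2) has_derivative (\<lambda>e. 2 * ((x - x0) \<bullet> e))) (at x)" for x
  proof -
    have "((\<lambda>x. (x - x0) \<bullet> (x - x0)) has_derivative (\<lambda>e. 2 * ((x - x0) \<bullet> e))) (at x)"
      by (auto intro!: derivative_eq_intros simp: inner_commute)
    moreover have "(\<lambda>x. (x - x0) \<bullet> (x - x0)) = (\<lambda>x. (dist x0 x)\<^sup>2)"
      by (simp add: fun_eq_iff dist_norm power2_norm_eq_inner norm_minus_commute flip: power2_norm_eq_inner)
    ultimately show ?thesis by simp
  qed
  have 2: "((\<lambda>x. 2 * ((x - x0) \<bullet> e)) has_derivative (\<lambda>e'. 2 * (e' \<bullet> e))) (at x)" for x e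
    by (auto intro!: derivative_eq_intros)
  show ?thesis
    by (rule Ck2_I[OF 1], rule Ck1_I[OF 2]) (rule continuous_on_const)
qed

section \<open>The second-derivative test along lines\<close>

lemma derivatives_along_line:
  fixes f :: "real^'n \<Rightarrow> real"
  assumes f: "Ck_on 2 S f"
  shows "u + s *\<^sub>R d \<in> S \<Longrightarrow>
      ((\<lambda>s. f (u + s *\<^sub>R d)) has_real_derivative (\<Sum>j\<in>UNIV. d $ j * partial j f (u + s *\<^sub>R d))) (at s)"
    and "u \<in> S \<Longrightarrow>
      ((\<lambda>s. \<Sum>j\<in>UNIV. d $ j * partial j f (u + s *\<^sub>R d)) has_real_derivative
        (\<Sum>i\<in>UNIV. \<Sum>j\<in>UNIV. d $ i * d $ j * partial i (partial j f) u)) (at 0)"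
proof -
  have gen: "((\<lambda>s. F (u + s *\<^sub>R d)) has_real_derivative (\<Sum>j\<in>UNIV. d $ j * partial j F (u + s *\<^sub>R d))) (at s)"
    if "F differentiable (at (u + s *\<^sub>R d))" for F :: "real^'n \<Rightarrow> real" and s
  proof -
    have 1: "(F has_derivative frechet_derivative F (at (u + s *\<^sub>R d))) (at (u + s *\<^sub>R d))"
      using that frechet_derivative_works by blast
    have "((\<lambda>s. u + s *\<^sub>R d) has_derivative (\<lambda>s. s *\<^sub>R d)) (at s)"
      by (auto intro!: derivative_eq_intros)
    from has_derivative_compose[OF this 1]
    have "((\<lambda>s. F (u + s *\<^sub>R d)) has_derivative (\<lambda>t. frechet_derivative F (at (u + s *\<^sub>R d)) (t *\<^sub>R d))) (at s)" .
    moreover have "frechet_derivative F (at (u + s *\<^sub>R d)) (t *\<^sub>R d) =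
        (\<Sum>j\<in>UNIV. d $ j * partial j F (u + s *\<^sub>R d)) * t" for t
      by (simp add: frechet_derivative_eq_sum_partial[OF that] sum_distrib_left sum_distrib_right mult_ac)
    ultimately show ?thesis by (simp add: has_field_derivative_def)
  qed
  show "u + s *\<^sub>R d \<in> S \<Longrightarrow>
      ((\<lambda>s. f (u + s *\<^sub>R d)) has_real_derivative (\<Sum>j\<in>UNIV. d $ j * partial j f (u + s *\<^sub>R d))) (at s)"
    by (rule gen) (use Ck2_D(1)[OF f] in blast)
  assume u: "u \<in> S"
  have "((\<lambda>s. \<Sum>j\<in>UNIV. d $ j * partial j f (u + s *\<^sub>R d)) has_real_derivative
        (\<Sum>j\<in>UNIV. d $ j * (\<Sum>i\<in>UNIV. d $ i * partial i (partial j f) (u + 0 *\<^sub>R d)))) (at 0)"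
    by (intro DERIV_sum DERIV_cmult gen) (use Ck2_D(3)[OF f u] in simp)
  moreover have "(\<Sum>j\<in>UNIV. d $ j * (\<Sum>i\<in>UNIV. d $ i * partial i (partial j f) (u + 0 *\<^sub>R d)))
     = (\<Sum>i\<in>UNIV. \<Sum>j\<in>UNIV. d $ i * d $ j * partial i (partial j f) u)"
    by (subst sum.swap) (simp add: sum_distrib_left mult_ac)
  ultimately show "((\<lambda>s. \<Sum>j\<in>UNIV. d $ j * partial j f (u + s *\<^sub>R d)) has_real_derivative
        (\<Sum>i\<in>UNIV. \<Sum>j\<in>UNIV. d $ i * d $ j * partial i (partial j f) u)) (at 0)"
    by simp
qed

lemma second_derivative_test_at_local_max:
  fixes g g' :: "real \<Rightarrow> real"
  assumes ev: "\<forall>\<^sub>F s in nhds 0. (g has_real_derivative g' s) (at s) \<and> g s \<le> g 0"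
    and D: "(g' has_real_derivative D) (at 0)"
  shows "g' 0 = 0" and "D \<le> 0"
proof -
  obtain e where e: "e > 0" "\<And>s. \<bar>s\<bar> < e \<Longrightarrow> (g has_real_derivative g' s) (at s) \<and> g s \<le> g 0"
    using ev unfolding eventually_nhds_metric dist_real_def by auto
  show g0: "g' 0 = 0"
    using DERIV_local_max[of g "g' 0" 0 e] e by (simp add: abs_minus_commute)
  show "D \<le> 0"
  proof (rule ccontr)
    assume "\<not> D \<le> 0"
    (* If D > 0 then g' > 0 just to the right of 0, so g increases there. *)
    then obtain d where d: "d > 0" "\<And>h. 0 < h \<Longrightarrow> h < d \<Longrightarrow> 0 < g' h"
      using DERIV_pos_inc_right[OF D] g0 by auto
    define t where "t = min d e / 2"
    have t: "0 < t" "t < d" "t < e" using d(1) e(1) by (auto simp: t_def)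
    have "\<exists>z. 0 < z \<and> z < t \<and> g t - g 0 = (t - 0) * g' z"
      by (rule MVT2) (use t e(2) in auto)
    then have "g t > g 0" using d(2) t by (smt (verit) mult_pos_pos)
    then show False using e(2)[of t] t by simp
  qed
qed

text \<open>The comparison function \<open>w\<close> is only given along the line, with a second derivative at the
  single parameter \<open>0\<close>: the radial function it is used for involves \<open>\<phi>b'\<close>, which may be
  discontinuous.\<close>

lemma second_order_test_along_line:
  fixes f :: "real^'n \<Rightarrow> real"
  assumes V: "open V" "u \<in> V" and f: "Ck_on 2 V f"
    and w: "\<forall>\<^sub>F s in nhds 0. (w has_real_derivative w' s) (at s)" "(w' has_real_derivative w'') (at 0)"
    and max: "\<forall>\<^sub>F s in nhds 0. f (u + s *\<^sub>R d) - w s \<le> f u - w 0"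
  shows "(\<Sum>j\<in>UNIV. d $ j * partial j f u) = w' 0"
    and "(\<Sum>i\<in>UNIV. \<Sum>j\<in>UNIV. d $ i * d $ j * partial i (partial j f) u) \<le> w''"
proof -
  define g where "g = (\<lambda>s. f (u + s *\<^sub>R d) - w s)"
  define g' where "g' = (\<lambda>s. (\<Sum>j\<in>UNIV. d $ j * partial j f (u + s *\<^sub>R d)) - w' s)"
  have "open ((\<lambda>s. u + s *\<^sub>R d) -` V)"
    by (rule open_vimage[OF V(1)]) (intro continuous_intros)
  moreover have "0 \<in> (\<lambda>s. u + s *\<^sub>R d) -` V" using V(2) by simp
  ultimately have "\<forall>\<^sub>F s in nhds 0. s \<in> (\<lambda>s. u + s *\<^sub>R d) -` V"
    by (rule eventually_nhds_in_open)
  then have "\<forall>\<^sub>F s in nhds 0. u + s *\<^sub>R d \<in> V" by simp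
  with w(1) max have ev: "\<forall>\<^sub>F s in nhds 0. (g has_real_derivative g' s) (at s) \<and> g s \<le> g 0"
  proof eventually_elim
    case (elim s)
    then show ?case
      unfolding g_def g'_def using DERIV_diff[OF derivatives_along_line(1)[OF f elim(3)] elim(1)] by simp
  qed
  have D: "(g' has_real_derivative (\<Sum>i\<in>UNIV. \<Sum>j\<in>UNIV. d $ i * d $ j * partial i (partial j f) u) - w'') (at 0)"
    unfolding g'_def by (rule DERIV_diff[OF derivatives_along_line(2)[OF f V(2)] w(2)])
  from second_derivative_test_at_local_max[OF ev D]
  show "(\<Sum>j\<in>UNIV. d $ j * partial j f u) = w' 0"
    "(\<Sum>i\<in>UNIV. \<Sum>j\<in>UNIV. d $ i * d $ j * partial i (partial j f) u) \<le> w''"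
    by (simp_all add: g'_def)
qed

section \<open>The Laplace-Beltrami operator in coordinates\<close>

text \<open>The coefficients \<open>\<surd>det G G\<^sup>i\<^sup>j\<close> of the vector field whose divergence defines the
  Laplace-Beltrami operator.\<close>

definition flux_coeff :: "(real^'n \<Rightarrow> real^'n^'n) \<Rightarrow> 'n \<Rightarrow> 'n \<Rightarrow> real^'n \<Rightarrow> real" where
  "flux_coeff G i j v = sqrt (det (G v)) * matrix_inv (G v) $ i $ j"

lemma laplace_beltrami_nondivergence:
  fixes f :: "real^'n \<Rightarrow> real"
  assumes "\<And>i j. flux_coeff G i j differentiable (at u)"
    and "\<And>j. partial j f differentiable (at u)"
  shows "laplace_beltrami G f u =
    (\<Sum>i\<in>UNIV. \<Sum>j\<in>UNIV. partial i (flux_coeff G i j) u * partial j f u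
        + flux_coeff G i j u * partial i (partial j f) u) / sqrt (det (G u))"
proof -
  have "partial i (\<lambda>v. flux_coeff G i j v * partial j f v) u =
      partial i (flux_coeff G i j) u * partial j f u + flux_coeff G i j u * partial i (partial j f) u" for i j
  proof -
    have 1: "(flux_coeff G i j has_derivative frechet_derivative (flux_coeff G i j) (at u)) (at u)"
      "(partial j f has_derivative frechet_derivative (partial j f) (at u)) (at u)"
      using assms frechet_derivative_works by blast+
    show ?thesis
      using partial_eqI[OF has_derivative_mult[OF 1], of i] by (simp add: partial_def)
  qed
  then show ?thesis
    unfolding laplace_beltrami_def flux_coeff_def[symmetric] by simp
qed

lemma laplace_beltrami_const: "laplace_beltrami G (\<lambda>_. c) x = 0"
  by (simp add: laplace_beltrami_def partial_def)

lemma matrix_inv_eqI: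
  fixes A :: "real^'n^'n"
  assumes "A ** B = mat 1"
  shows "matrix_inv A = B"
proof -
  have "B ** A = mat 1" using assms matrix_left_right_inverse by blast
  then have "\<exists>A'. A ** A' = mat 1 \<and> A' ** A = mat 1" using assms by blast
  then have "A ** matrix_inv A = mat 1 \<and> matrix_inv A ** A = mat 1"
    unfolding matrix_inv_def by (rule someI_ex)
  then show ?thesis
    using \<open>B ** A = mat 1\<close> matrix_mul_assoc[of B A "matrix_inv A"] by simp
qed

text \<open>Positive definiteness of a symmetric \<open>2 \<times> 2\<close> matrix by its leading minors.\<close>

definition spd_2 :: "real^2^2 \<Rightarrow> bool" where
  "spd_2 A \<longleftrightarrow> A $ 2 $ 1 = A $ 1 $ 2 \<and> 0 < A $ 1 $ 1 \<and> 0 < det A"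

lemma spd_2I:
  fixes A :: "real^2^2"
  assumes sym: "transpose A = A" and pos: "\<And>w. w \<noteq> 0 \<Longrightarrow> 0 < w \<bullet> (A *v w)"
  shows "spd_2 A"
proof -
  have s: "A $ 2 $ 1 = A $ 1 $ 2"
    using arg_cong[OF sym, of "\<lambda>B. B $ 1 $ 2"] by (simp add: transpose_def)
  have e: "w \<bullet> (A *v w) = w$1 * (A$1$1 * w$1 + A$1$2 * w$2) + w$2 * (A$2$1 * w$1 + A$2$2 * w$2)" for w
    by (simp add: inner_vec_def matrix_vector_mult_def sum_2)
  have nz: "vector [a, b] \<noteq> (0::real^2)" if "a \<noteq> 0 \<or> b \<noteq> 0" for a b
    using that by (simp add: vec_eq_iff forall_2)
  have p: "0 < A$1$1" using pos[OF nz, of 1 0] by (simp add: e)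
  (* The second test vector makes the quadratic form equal to A$1$1 times the determinant. *)
  have "0 < A$1$1 * (A$1$1 * A$2$2 - A$1$2 * A$2$1)"
    using pos[OF nz, of "- A$1$2" "A$1$1"] p s by (simp add: e algebra_simps)
  then have "0 < det A" using p by (simp add: det_2 zero_less_mult_iff)
  then show ?thesis using s p by (simp add: spd_2_def)
qed

lemma matrix_inv_2:
  fixes A :: "real^2^2"
  assumes "det A \<noteq> 0"
  shows "matrix_inv A = vector [vector [A$2$2 / det A, - A$1$2 / det A],
                                vector [- A$2$1 / det A, A$1$1 / det A]]"
proof (rule matrix_inv_eqI)
  have *: "a * (d / D) + b * (- c / D) = 1 \<and> a * (- b / D) + b * (a / D) = 0 \<and>
      c * (d / D) + d * (- c / D) = 0 \<and> c * (- b / D) + d * (a / D) = 1"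
    if "a * d - b * c = D" "D \<noteq> 0" for a b c d D :: real
    unfolding that(1)[symmetric] using that by (simp add: field_simps)
  show "A ** vector [vector [A$2$2 / det A, - A$1$2 / det A],
                     vector [- A$2$1 / det A, A$1$1 / det A]] = mat 1"
    using *[OF det_2[symmetric] assms]
    unfolding vec_eq_iff forall_2 matrix_matrix_mult_def mat_def by (simp add: sum_2)
qed

lemma flux_coeff_2:
  assumes "spd_2 (E x)"
  shows "flux_coeff E 1 1 x = E x $ 2 $ 2 * inverse (sqrt (det (E x)))"
    and "flux_coeff E 1 2 x = - (E x $ 1 $ 2 * inverse (sqrt (det (E x))))"
    and "flux_coeff E 2 1 x = - (E x $ 2 $ 1 * inverse (sqrt (det (E x))))"
    and "flux_coeff E 2 2 x = E x $ 1 $ 1 * inverse (sqrt (det (E x)))"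
proof -
  have d: "0 < det (E x)" using assms by (simp add: spd_2_def)
  have "sqrt (det (E x)) * c / det (E x) = c * inverse (sqrt (det (E x)))" for c
    using d by (simp add: divide_simps)
  then show "flux_coeff E 1 1 x = E x $ 2 $ 2 * inverse (sqrt (det (E x)))"
    "flux_coeff E 1 2 x = - (E x $ 1 $ 2 * inverse (sqrt (det (E x))))"
    "flux_coeff E 2 1 x = - (E x $ 2 $ 1 * inverse (sqrt (det (E x))))"
    "flux_coeff E 2 2 x = E x $ 1 $ 1 * inverse (sqrt (det (E x)))"
    using d by (simp_all add: flux_coeff_def matrix_inv_2)
qed

text \<open>In dimension two the flux coefficients form a positive definite matrix of determinant one,
  since \<open>\<surd>det G G\<^sup>-\<^sup>1\<close> has determinant \<open>det G / det G\<close>.\<close>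

lemma flux_coeff_2_spd:
  assumes "spd_2 (E x)"
  shows "flux_coeff E 2 1 x = flux_coeff E 1 2 x" and "0 < flux_coeff E 1 1 x"
    and "flux_coeff E 1 1 x * flux_coeff E 2 2 x - (flux_coeff E 1 2 x)\<^sup>2 = 1"
proof -
  have d: "0 < det (E x)" and s: "E x $ 2 $ 1 = E x $ 1 $ 2" and p: "0 < E x $ 1 $ 1"
    using assms by (simp_all add: spd_2_def)
  have "0 < E x $ 1 $ 1 * E x $ 2 $ 2"
    using d s by (simp add: det_2) (smt (verit) zero_le_square)
  then have "0 < E x $ 2 $ 2" using p by (simp add: zero_less_mult_iff)
  then show "flux_coeff E 2 1 x = flux_coeff E 1 2 x" "0 < flux_coeff E 1 1 x"
    using s d by (simp_all add: flux_coeff_2[of E x, OF assms])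
  have i: "inverse (sqrt (det (E x))) * inverse (sqrt (det (E x))) = inverse (det (E x))"
    using d by (simp flip: inverse_mult_distrib)
  have "flux_coeff E 1 1 x * flux_coeff E 2 2 x - (flux_coeff E 1 2 x)\<^sup>2 =
     (E x $ 1 $ 1 * E x $ 2 $ 2 - E x $ 1 $ 2 * E x $ 2 $ 1) * (inverse (sqrt (det (E x))) * inverse (sqrt (det (E x))))"
    using s by (simp add: flux_coeff_2[of E x, OF assms] power2_eq_square algebra_simps)
  also have "\<dots> = det (E x) * inverse (det (E x))" unfolding i by (simp add: det_2)
  also have "\<dots> = 1" using d by simp
  finally show "flux_coeff E 1 1 x * flux_coeff E 2 2 x - (flux_coeff E 1 2 x)\<^sup>2 = 1" .
qed

lemma Ck1_flux_coeff_2: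
  assumes U: "open U" and E: "Ck_on (Suc 0) U E" and spd: "\<And>x. x \<in> U \<Longrightarrow> spd_2 (E x)"
  shows "Ck_on (Suc 0) U (flux_coeff E i j)" and "Ck_on (Suc 0) U (\<lambda>x. det (E x))"
proof -
  have comp: "Ck_on (Suc 0) U (\<lambda>x. E x $ k $ l)" for k l
    using Ck1_bounded_linear[OF bounded_linear_vec_nth, OF Ck1_bounded_linear[OF bounded_linear_vec_nth, OF E]] .
  show d: "Ck_on (Suc 0) U (\<lambda>x. det (E x))"
    unfolding det_2 by (intro Ck1_diff Ck1_mult comp)
  have dp: "0 < det (E x)" if "x \<in> U" for x
    using spd[OF that] by (simp add: spd_2_def)
  have s: "Ck_on (Suc 0) U (\<lambda>x. inverse (sqrt (det (E x))))"
  proof (rule Ck1_compose[OF d, where \<psi>' = "\<lambda>t. - (inverse (sqrt t) / 2) * (inverse (sqrt t))\<^sup>2"])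
    show "((\<lambda>t. inverse (sqrt t)) has_real_derivative
        - (inverse (sqrt (det (E x))) / 2) * (inverse (sqrt (det (E x))))\<^sup>2) (at (det (E x)))"
      if "x \<in> U" for x
      using dp[OF that] by (auto intro!: derivative_eq_intros simp: power2_eq_square mult_ac)
    show "continuous_on U (\<lambda>x. - (inverse (sqrt (det (E x))) / 2) * (inverse (sqrt (det (E x))))\<^sup>2)"
      using Ck1_imp_continuous_on[OF d] dp
      by (auto intro!: continuous_intros) (metis less_irrefl)+
  qed
  have "Ck_on (Suc 0) U (flux_coeff E 1 1)"
    by (rule Ck1_cong[OF U Ck1_mult[OF comp s]]) (rule flux_coeff_2(1)[of E, OF spd])
  moreover have "Ck_on (Suc 0) U (flux_coeff E 1 2)"
    by (rule Ck1_cong[OF U Ck1_minus[OF Ck1_mult[OF comp s]]]) (rule flux_coeff_2(2)[of E, OF spd])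
  moreover have "Ck_on (Suc 0) U (flux_coeff E 2 1)"
    by (rule Ck1_cong[OF U Ck1_minus[OF Ck1_mult[OF comp s]]]) (rule flux_coeff_2(3)[of E, OF spd])
  moreover have "Ck_on (Suc 0) U (flux_coeff E 2 2)"
    by (rule Ck1_cong[OF U Ck1_mult[OF comp s]]) (rule flux_coeff_2(4)[of E, OF spd])
  ultimately show "Ck_on (Suc 0) U (flux_coeff E i j)"
    using exhaust_2[of i] exhaust_2[of j] by auto
qed

lemma continuous_on_laplace_beltrami_2:
  assumes U: "open U" and E: "Ck_on (Suc 0) U E" and spd: "\<And>x. x \<in> U \<Longrightarrow> spd_2 (E x)"
    and q: "Ck_on 2 U q"
  shows "continuous_on U (laplace_beltrami E q)"
proof -
  note F = Ck1_flux_coeff_2[OF U E spd]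
  have eq: "laplace_beltrami E q x = (\<Sum>i\<in>UNIV. \<Sum>j\<in>UNIV. partial i (flux_coeff E i j) x * partial j q x
        + flux_coeff E i j x * partial i (partial j q) x) / sqrt (det (E x))" if "x \<in> U" for x
    by (rule laplace_beltrami_nondivergence) (use F(1) Ck2_D(3)[OF q] that in auto)
  have p: "continuous_on U (partial i (flux_coeff E i j))" for i j
    using F(1)[of i j] unfolding Ck1_iff partial_def[abs_def] by simp
  have "continuous_on U (\<lambda>x. (\<Sum>i\<in>UNIV. \<Sum>j\<in>UNIV. partial i (flux_coeff E i j) x * partial j q x
        + flux_coeff E i j x * partial i (partial j q) x) / sqrt (det (E x)))"
    using spd by (intro continuous_intros p Ck2_D(4,5)[OF q] Ck1_imp_continuous_on F)
      (fastforce simp: spd_2_def)+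
  then show ?thesis using eq by (simp cong: continuous_on_cong)
qed

section \<open>The Laplace-Beltrami operator of a warped product\<close>

definition base_coords :: "real^3 \<Rightarrow> real^2" where
  "base_coords v = vector [v $ 1, v $ 2]"

text \<open>The coordinate of \<open>\<real>\<^sup>3\<close> in which a coordinate of the base surface appears; the
  third coordinate is \<open>r\<close>.\<close>

definition base_index :: "2 \<Rightarrow> 3" where
  "base_index i = (if i = 1 then 1 else 2)"

lemma base_index_simps [simp]: "base_index 1 = 1" "base_index 2 = 2"
  by (simp_all add: base_index_def)

lemma base_coords_nth [simp]: "base_coords v $ i = v $ base_index i"
  using exhaust_2[of i] by (auto simp: base_coords_def)

lemma linear_base_coords: "linear base_coords"
  by (rule linearI) (simp_all add: vec_eq_iff)

lemma bounded_linear_base_coords: "bounded_linear base_coords"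
  using linear_base_coords by (simp add: linear_conv_bounded_linear)

lemma base_coords_axis [simp]:
  "base_coords (axis (base_index i) 1) = axis i 1" "base_coords (axis 3 1) = 0"
  using exhaust_2[of i] by (auto simp: vec_eq_iff forall_2 axis_def)

text \<open>The matrix of the metric \<open>dr\<^sup>2 + c g\<close>; its inverse is again of this form, which keeps the
  computation of the flux coefficients in block form.\<close>

definition warped_matrix :: "real \<Rightarrow> real^2^2 \<Rightarrow> real^3^3" where
  "warped_matrix c g = vector [vector [c * g $ 1 $ 1, c * g $ 1 $ 2, 0],
                    vector [c * g $ 2 $ 1, c * g $ 2 $ 2, 0],
                    vector [0, 0, 1]]"

lemma det_warped_matrix: "det (warped_matrix c g) = c\<^sup>2 * det g"
  by (simp add: det_3 det_2 warped_matrix_def power2_eq_square algebra_simps)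

lemma matrix_inv_warped_matrix:
  assumes "c \<noteq> 0" "det g \<noteq> 0"
  shows "matrix_inv (warped_matrix c g) = warped_matrix (1 / c) (matrix_inv g)"
proof (rule matrix_inv_eqI)
  have "invertible g" using assms invertible_det_nz by blast
  then have "g ** matrix_inv g = mat 1"
    unfolding matrix_inv_def invertible_def by (rule someI2_ex) blast
  then have "(g ** matrix_inv g) $ i $ j = (if i = j then 1 else 0)" for i j
    by (simp add: mat_def)
  from this[of 1 1] this[of 1 2] this[of 2 1] this[of 2 2]
  have e: "g$1$1 * matrix_inv g$1$1 + g$1$2 * matrix_inv g$2$1 = 1"
    "g$1$1 * matrix_inv g$1$2 + g$1$2 * matrix_inv g$2$2 = 0"
    "g$2$1 * matrix_inv g$1$1 + g$2$2 * matrix_inv g$2$1 = 0"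
    "g$2$1 * matrix_inv g$1$2 + g$2$2 * matrix_inv g$2$2 = 1"
    by (simp_all add: matrix_matrix_mult_def sum_2)
  have c: "c * (1 / c) = 1" using assms(1) by simp
  have r: "c * a * (1 / c * b) + c * a' * (1 / c * b') = a * b + a' * b'" for a b a' b'
    using assms(1) by (simp add: field_simps)
  show "warped_matrix c g ** warped_matrix (1 / c) (matrix_inv g) = mat 1"
    unfolding vec_eq_iff forall_3 matrix_matrix_mult_def mat_def warped_matrix_def
    by (simp add: sum_3 r e del: times_divide_eq_left times_divide_eq_right mult_1_left)
qed

text \<open>The factor \<open>p\<^sup>2\<close> from \<open>\<surd>det G = p\<^sup>2 \<surd>det E\<close> and the factor \<open>p\<^sup>-\<^sup>2\<close> from the
  inverse matrix cancel in the horizontal block; this is the conformal invariance of the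
  two-dimensional Laplacian.\<close>

lemma flux_coeff_warped:
  assumes "G v = warped_matrix ((p v)\<^sup>2) (E (base_coords v))"
    and "0 < p v" "spd_2 (E (base_coords v))"
  shows "flux_coeff G (base_index i) (base_index j) v = flux_coeff E i j (base_coords v)"
    and "flux_coeff G 3 3 v = (p v)\<^sup>2 * sqrt (det (E (base_coords v)))"
    and "flux_coeff G (base_index i) 3 v = 0" and "flux_coeff G 3 (base_index i) v = 0"
proof -
  have d: "det (E (base_coords v)) \<noteq> 0" "0 < det (E (base_coords v))"
    using assms(3) by (auto simp: spd_2_def)
  have s: "sqrt (((p v)\<^sup>2)\<^sup>2 * det (E (base_coords v))) = (p v)\<^sup>2 * sqrt (det (E (base_coords v)))"
    unfolding real_sqrt_mult real_sqrt_abs by simp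
  have m: "matrix_inv (G v) = warped_matrix (1 / (p v)\<^sup>2) (matrix_inv (E (base_coords v)))"
    unfolding assms(1) using assms(2) d by (intro matrix_inv_warped_matrix) auto
  have sd: "sqrt (det (G v)) = (p v)\<^sup>2 * sqrt (det (E (base_coords v)))"
    unfolding assms(1) det_warped_matrix s ..
  show "flux_coeff G (base_index i) (base_index j) v = flux_coeff E i j (base_coords v)"
    using assms(2) exhaust_2[of i] exhaust_2[of j]
    unfolding flux_coeff_def sd m by (auto simp: warped_matrix_def)
  show "flux_coeff G 3 3 v = (p v)\<^sup>2 * sqrt (det (E (base_coords v)))"
    "flux_coeff G (base_index i) 3 v = 0" "flux_coeff G 3 (base_index i) v = 0"
    using exhaust_2[of i] unfolding flux_coeff_def sd m by (auto simp: warped_matrix_def)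
qed

lemma sum_UNIV_3_base_index: "sum F (UNIV::3 set) = (\<Sum>i\<in>UNIV. F (base_index i)) + F 3"
  by (simp add: sum_3 sum_2)

lemma has_derivative_base_coords_comp:
  assumes "F differentiable (at (base_coords u))"
  shows "((\<lambda>v. F (base_coords v)) has_derivative
      (\<lambda>d. frechet_derivative F (at (base_coords u)) (base_coords d))) (at u)"
  using has_derivative_compose[OF bounded_linear_imp_has_derivative[OF bounded_linear_base_coords]]
    assms frechet_derivative_works by blast

text \<open>Only the vertical coefficient \<open>p\<^sup>2 \<surd>det E\<close> depends on \<open>p\<close>, and it is
  differentiated only in \<open>r\<close>; this yields the first-order term \<open>2 (p\<^sub>r/p) f\<^sub>r\<close>.\<close>

lemma laplace_beltrami_warped:
  fixes f p :: "real^3 \<Rightarrow> real" and E :: "real^2 \<Rightarrow> real^2^2"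
  assumes V: "open V" "u \<in> V" and U: "open U" "\<And>v. v \<in> V \<Longrightarrow> base_coords v \<in> U"
    and E: "Ck_on (Suc 0) U E" and spd: "\<And>x. x \<in> U \<Longrightarrow> spd_2 (E x)"
    and G: "\<And>v. v \<in> V \<Longrightarrow> G v = warped_matrix ((p v)\<^sup>2) (E (base_coords v))"
    and p: "\<And>v. v \<in> V \<Longrightarrow> 0 < p v" "p differentiable (at u)"
    and f: "Ck_on 2 V f"
  shows "laplace_beltrami G f u = partial 3 (partial 3 f) u
    + 2 * (partial 3 p u / p u) * partial 3 f u
    + (\<Sum>i\<in>UNIV. \<Sum>j\<in>UNIV.
         partial i (flux_coeff E i j) (base_coords u) * partial (base_index j) f u
         + flux_coeff E i j (base_coords u) * partial (base_index i) (partial (base_index j) f) u)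
      / sqrt (det (E (base_coords u))) / (p u)\<^sup>2"
proof -
  note FE = Ck1_flux_coeff_2[OF U(1) E spd]
  have uU: "base_coords u \<in> U" using U V by blast
  have near: "(flux_coeff G i j has_derivative D) (at u)"
    if "(F has_derivative D) (at u)" "\<And>v. v \<in> V \<Longrightarrow> flux_coeff G i j v = F v" for F D i j
    using has_derivative_transform_within_open[OF that(1) V] that(2) by simp
  have warp: "flux_coeff G (base_index i) (base_index j) v = flux_coeff E i j (base_coords v)"
    "flux_coeff G 3 3 v = (p v)\<^sup>2 * sqrt (det (E (base_coords v)))"
    "flux_coeff G (base_index i) 3 v = 0" "flux_coeff G 3 (base_index i) v = 0" if "v \<in> V" for v i j
    using flux_coeff_warped[of G v p E, OF G[OF that] p(1)[OF that] spd[OF U(2)[OF that]]] by auto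
  have b: "(flux_coeff G (base_index i) (base_index j) has_derivative
      (\<lambda>d. frechet_derivative (flux_coeff E i j) (at (base_coords u)) (base_coords d))) (at u)" for i j
    by (rule near[OF has_derivative_base_coords_comp warp(1)]) (use FE(1) uU in auto)
  have z: "(flux_coeff G (base_index i) 3 has_derivative (\<lambda>d. 0)) (at u)"
    "(flux_coeff G 3 (base_index i) has_derivative (\<lambda>d. 0)) (at u)" for i
    by (rule near[OF has_derivative_const], simp add: warp)+
  define Q where "Q = (\<lambda>x. sqrt (det (E x)))"
  have dpos: "0 < det (E (base_coords u))" using spd[OF uU] by (simp add: spd_2_def)
  then have Qpos: "0 < Q (base_coords u)" by (simp add: Q_def)
  have "(\<lambda>x. det (E x)) differentiable (at (base_coords u))" using FE(2) uU by simp
  then obtain D' where "((\<lambda>x. det (E x)) has_derivative D') (at (base_coords u))"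
    unfolding differentiable_def by blast
  from has_derivative_real_sqrt[OF dpos this] have "Q differentiable (at (base_coords u))"
    unfolding Q_def differentiable_def by blast
  note dQ = has_derivative_base_coords_comp[OF this]
  have linQ: "linear (frechet_derivative Q (at (base_coords u)))"
    using \<open>Q differentiable _\<close> linear_frechet_derivative by blast
  have dp: "(p has_derivative frechet_derivative p (at u)) (at u)"
    using p(2) frechet_derivative_works by blast
  have r: "(flux_coeff G 3 3 has_derivative
      (\<lambda>d. (p u)\<^sup>2 * frechet_derivative Q (at (base_coords u)) (base_coords d)
         + (2 * p u * frechet_derivative p (at u) d) * Q (base_coords u))) (at u)"
  proof (rule near)
    show "((\<lambda>v. (p v)\<^sup>2 * Q (base_coords v)) has_derivative
      (\<lambda>d. (p u)\<^sup>2 * frechet_derivative Q (at (base_coords u)) (base_coords d)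
         + (2 * p u * frechet_derivative p (at u) d) * Q (base_coords u))) (at u)"
      by (rule has_derivative_eq_rhs[OF has_derivative_mult[OF has_derivative_power[OF dp, of 2] dQ]])
        (simp add: fun_eq_iff)
    show "flux_coeff G 3 3 v = (p v)\<^sup>2 * Q (base_coords v)" if "v \<in> V" for v
      using warp(2)[OF that] by (simp add: Q_def)
  qed
  have P: "partial (base_index i) (flux_coeff G (base_index i) (base_index j)) u
      = partial i (flux_coeff E i j) (base_coords u)"
    "partial (base_index i) (flux_coeff G (base_index i) 3) u = 0"
    "partial 3 (flux_coeff G 3 (base_index i)) u = 0"
    "partial 3 (flux_coeff G 3 3) u = 2 * p u * partial 3 p u * Q (base_coords u)" for i j
    using partial_eqI[OF b[of i j], of "base_index i"] partial_eqI[OF z(1)[of i], of "base_index i"]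
      partial_eqI[OF z(2)[of i], of 3] partial_eqI[OF r, of 3]
    by (simp_all add: partial_def linear_0[OF linQ])
  have diff: "flux_coeff G i j differentiable (at u)" for i j
  proof -
    have "i = 3 \<or> (\<exists>k. i = base_index k)" for i
      using exhaust_3[of i] base_index_simps[symmetric] by blast
    from this[of i] this[of j] show ?thesis using b z r unfolding differentiable_def by blast
  qed
  have pu: "0 < p u" using p V by blast
  have sG: "sqrt (det (G u)) = (p u)\<^sup>2 * Q (base_coords u)"
    unfolding G[OF V(2)] det_warped_matrix Q_def real_sqrt_mult real_sqrt_abs by simp
  define S where "S = (\<Sum>i\<in>UNIV. \<Sum>j\<in>UNIV.
         partial i (flux_coeff E i j) (base_coords u) * partial (base_index j) f u
         + flux_coeff E i j (base_coords u) * partial (base_index i) (partial (base_index j) f) u)"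
  have "laplace_beltrami G f u =
    (\<Sum>i\<in>UNIV. \<Sum>j\<in>UNIV. partial i (flux_coeff G i j) u * partial j f u
        + flux_coeff G i j u * partial i (partial j f) u) / sqrt (det (G u))"
    by (rule laplace_beltrami_nondivergence) (use diff Ck2_D(3)[OF f V(2)] in auto)
  also have "\<dots> = (S + 2 * p u * partial 3 p u * Q (base_coords u) * partial 3 f u
      + (p u)\<^sup>2 * Q (base_coords u) * partial 3 (partial 3 f) u) / ((p u)\<^sup>2 * Q (base_coords u))"
    unfolding sum_UNIV_3_base_index P warp[OF V(2)] sG S_def
    by (simp add: sum.distrib Q_def)
  also have "\<dots> = partial 3 (partial 3 f) u
    + 2 * (partial 3 p u / p u) * partial 3 f u + S / Q (base_coords u) / (p u)\<^sup>2"
    using pu Qpos by (simp add: field_simps power2_eq_square)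
  finally show ?thesis by (simp add: S_def Q_def)
qed

text \<open>The trace of the product of a positive semidefinite matrix and a Hessian is monotone in the
  Hessian.  Completing the square writes it as a positive combination of the second derivatives
  in the directions \<open>(1, b/a)\<close> and \<open>(0, 1)\<close>, so that only second derivatives along lines need
  to be compared.\<close>

lemma trace_inequality_2:
  fixes a b c h11 h12 h21 h22 k11 k12 k21 k22 :: real
  assumes a: "0 < a" and det: "0 \<le> a * c - b\<^sup>2"
    and le: "h22 \<le> k22"
      "\<And>t. h11 + t * (h12 + h21) + t\<^sup>2 * h22 \<le> k11 + t * (k12 + k21) + t\<^sup>2 * k22"
  shows "a * h11 + b * h12 + b * h21 + c * h22 \<le> a * k11 + b * k12 + b * k21 + c * k22"
proof -
  have split: "a * x + b * y + b * y' + c * z = a * (x + (b / a) * (y + y') + (b / a)\<^sup>2 * z) + (a * c - b\<^sup>2) / a * z"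
    for x y y' z
    using a by (simp add: field_simps power2_eq_square)
  have "a * (h11 + (b / a) * (h12 + h21) + (b / a)\<^sup>2 * h22) \<le> a * (k11 + (b / a) * (k12 + k21) + (b / a)\<^sup>2 * k22)"
    by (rule mult_left_mono[OF le(2) less_imp_le[OF a]])
  moreover have "(a * c - b\<^sup>2) / a * h22 \<le> (a * c - b\<^sup>2) / a * k22"
    using a det le(1) by (intro mult_left_mono divide_nonneg_pos) auto
  ultimately show ?thesis unfolding split by linarith
qed

text \<open>At a local maximum of \<open>f - (q + a)\<close> the gradients agree, and the second derivative of \<open>f\<close>
  along each vertical or horizontal line is at most that of \<open>q + a\<close>.  The block form of the
  Laplacian combines exactly these.\<close>

lemma laplace_beltrami_le_at_touching_point:
  fixes f p :: "real^3 \<Rightarrow> real" and E :: "real^2 \<Rightarrow> real^2^2"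
    and q :: "real^2 \<Rightarrow> real" and a a' :: "real \<Rightarrow> real"
  assumes V: "open V" "u \<in> V" and U: "open U" "\<And>v. v \<in> V \<Longrightarrow> base_coords v \<in> U"
    and E: "Ck_on (Suc 0) U E" and spd: "\<And>x. x \<in> U \<Longrightarrow> spd_2 (E x)"
    and G: "\<And>v. v \<in> V \<Longrightarrow> G v = warped_matrix ((p v)\<^sup>2) (E (base_coords v))"
    and p: "\<And>v. v \<in> V \<Longrightarrow> 0 < p v" "p differentiable (at u)"
    and f: "Ck_on 2 V f" and q: "Ck_on 2 U q"
    and a: "\<forall>\<^sub>F r in nhds (u $ 3). (a has_real_derivative a' r) (at r)"
      "(a' has_real_derivative a'') (at (u $ 3))"
    and max: "\<forall>\<^sub>F v in nhds u. f v - (q (base_coords v) + a (v $ 3)) \<le> f u - (q (base_coords u) + a (u $ 3))"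
  shows "laplace_beltrami G f u \<le> a'' + 2 * (partial 3 p u / p u) * a' (u $ 3)
      + laplace_beltrami E q (base_coords u) / (p u)\<^sup>2"
proof -
  define x where "x = base_coords u"
  have xU: "x \<in> U" using U V by (simp add: x_def)
  have line: "\<forall>\<^sub>F s in nhds 0. P (u + s *\<^sub>R d)" if "\<forall>\<^sub>F v in nhds u. P v" for P and d :: "real^3"
  proof -
    have "((\<lambda>s. u + s *\<^sub>R d) \<longlongrightarrow> u + 0 *\<^sub>R d) (nhds 0)" by (intro tendsto_intros filterlim_ident)
    then have "filterlim (\<lambda>s. u + s *\<^sub>R d) (nhds u) (nhds 0)" by simp
    from eventually_compose_filterlim[OF that this] show ?thesis .
  qed
    have vert: "partial 3 f u = a' (u $ 3)" "partial 3 (partial 3 f) u \<le> a''"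
  proof -
    have nth: "(u + s *\<^sub>R axis 3 1) $ 3 = u $ 3 + s" "base_coords (u + s *\<^sub>R axis 3 1) = base_coords u" for s
      by (simp_all add: linear_add[OF linear_base_coords] linear_scale[OF linear_base_coords])
    have sh: "((\<lambda>s. u $ 3 + s) \<longlongrightarrow> u $ 3 + 0) (nhds 0)" by (intro tendsto_intros filterlim_ident)
    have "\<forall>\<^sub>F s in nhds 0. (a has_real_derivative a' (u $ 3 + s)) (at (u $ 3 + s))"
      using eventually_compose_filterlim[OF a(1), of "\<lambda>s. u $ 3 + s" "nhds 0"] sh by simp
    then have 1: "\<forall>\<^sub>F s in nhds 0. ((\<lambda>s. a (u $ 3 + s)) has_real_derivative a' (u $ 3 + s)) (at s)"
      by eventually_elim (simp add: DERIV_shift add.commute)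
    have 2: "((\<lambda>s. a' (u $ 3 + s)) has_real_derivative a'') (at 0)"
      using a(2) by (simp add: DERIV_shift[symmetric] add.commute)
    have 3: "\<forall>\<^sub>F s in nhds 0. f (u + s *\<^sub>R axis 3 1) - a (u $ 3 + s) \<le> f u - a (u $ 3 + 0)"
      using line[OF max, of "axis 3 1"] by (simp add: nth)
    have sum3: "(\<Sum>j\<in>UNIV. axis 3 1 $ j * F j) = F 3" for F :: "3 \<Rightarrow> real"
      by (simp add: sum_3 axis_def)
    note T = second_order_test_along_line[OF V f 1 2 3]
    show "partial 3 f u = a' (u $ 3)" using T(1) by (simp add: sum3)
    show "partial 3 (partial 3 f) u \<le> a''"
      using T(2) by (simp add: mult.assoc sum3 flip: sum_distrib_left)
  qed
    have hor: "(\<Sum>j\<in>UNIV. d $ j * partial (base_index j) f u) = (\<Sum>j\<in>UNIV. d $ j * partial j q x)"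
    "(\<Sum>i\<in>UNIV. \<Sum>j\<in>UNIV. d $ i * d $ j * partial (base_index i) (partial (base_index j) f) u)
      \<le> (\<Sum>i\<in>UNIV. \<Sum>j\<in>UNIV. d $ i * d $ j * partial i (partial j q) x)" for d :: "real^2"
  proof -
    define D :: "real^3" where "D = vector [d $ 1, d $ 2, 0]"
    have D: "D $ 3 = 0" "D $ base_index i = d $ i" "base_coords D = d" for i
      using exhaust_2[of i] by (auto simp: D_def vec_eq_iff forall_2)
    have nth: "(u + s *\<^sub>R D) $ 3 = u $ 3" "base_coords (u + s *\<^sub>R D) = x + s *\<^sub>R d" for s
      by (simp_all add: linear_add[OF linear_base_coords] linear_scale[OF linear_base_coords] D x_def)
    have "open ((\<lambda>s. x + s *\<^sub>R d) -` U)"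
      by (rule open_vimage[OF U(1)]) (intro continuous_intros)
    then have "\<forall>\<^sub>F s in nhds 0. s \<in> (\<lambda>s. x + s *\<^sub>R d) -` U"
      by (rule eventually_nhds_in_open) (use xU in simp)
    then have 1: "\<forall>\<^sub>F s in nhds 0. ((\<lambda>s. q (x + s *\<^sub>R d)) has_real_derivative
        (\<Sum>j\<in>UNIV. d $ j * partial j q (x + s *\<^sub>R d))) (at s)"
      by eventually_elim (rule derivatives_along_line(1)[OF q], simp)
    note 2 = derivatives_along_line(2)[OF q xU, of d]
    have 3: "\<forall>\<^sub>F s in nhds 0. f (u + s *\<^sub>R D) - q (x + s *\<^sub>R d) \<le> f u - q (x + 0 *\<^sub>R d)"
      using line[OF max, of D] by (simp add: nth D(1) x_def[symmetric])
    note T = second_order_test_along_line[OF V f 1 2 3]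
    show "(\<Sum>j\<in>UNIV. d $ j * partial (base_index j) f u) = (\<Sum>j\<in>UNIV. d $ j * partial j q x)"
      using T(1) by (simp add: sum_UNIV_3_base_index D del: base_index_simps)
    show "(\<Sum>i\<in>UNIV. \<Sum>j\<in>UNIV. d $ i * d $ j * partial (base_index i) (partial (base_index j) f) u)
      \<le> (\<Sum>i\<in>UNIV. \<Sum>j\<in>UNIV. d $ i * d $ j * partial i (partial j q) x)"
      using T(2) by (simp add: sum_UNIV_3_base_index D del: base_index_simps)
  qed
  have grad: "partial (base_index j) f u = partial j q x" for j
    using hor(1)[of "axis j 1"] exhaust_2[of j] by (auto simp: sum_2 axis_def)
  define H where "H = (\<lambda>i j. partial (base_index i) (partial (base_index j) f) u)"
  define K where "K = (\<lambda>i j. partial i (partial j q) x)"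
  define A where "A = (\<lambda>i j. flux_coeff E i j x)"
  have HK: "d $ 1 * d $ 1 * H 1 1 + d $ 1 * d $ 2 * H 1 2 + (d $ 2 * d $ 1 * H 2 1 + d $ 2 * d $ 2 * H 2 2)
      \<le> d $ 1 * d $ 1 * K 1 1 + d $ 1 * d $ 2 * K 1 2 + (d $ 2 * d $ 1 * K 2 1 + d $ 2 * d $ 2 * K 2 2)" for d :: "real^2"
    using hor(2)[of d] unfolding H_def K_def sum_2 .
  have A: "A 2 1 = A 1 2" "0 < A 1 1" "A 1 1 * A 2 2 - (A 1 2)\<^sup>2 = 1"
    unfolding A_def using flux_coeff_2_spd[of E x, OF spd[OF xU]] by auto
  have trace: "(\<Sum>i\<in>UNIV. \<Sum>j\<in>UNIV. A i j * H i j) \<le> (\<Sum>i\<in>UNIV. \<Sum>j\<in>UNIV. A i j * K i j)"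
  proof -
    have "A 1 1 * H 1 1 + A 1 2 * H 1 2 + A 1 2 * H 2 1 + A 2 2 * H 2 2
      \<le> A 1 1 * K 1 1 + A 1 2 * K 1 2 + A 1 2 * K 2 1 + A 2 2 * K 2 2"
    proof (rule trace_inequality_2[OF A(2)])
      show "0 \<le> A 1 1 * A 2 2 - (A 1 2)\<^sup>2" using A(3) by simp
      show "H 2 2 \<le> K 2 2" using HK[of "vector [0, 1]"] by simp
      show "H 1 1 + t * (H 1 2 + H 2 1) + t\<^sup>2 * H 2 2 \<le> K 1 1 + t * (K 1 2 + K 2 1) + t\<^sup>2 * K 2 2" for t
        using HK[of "vector [1, t]"] by (simp add: power2_eq_square algebra_simps)
    qed
    then show ?thesis by (simp add: sum_2 A(1))
  qed
  have dpos: "0 < sqrt (det (E x))" using spd[OF xU] by (simp add: spd_2_def)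
  have pu: "0 < (p u)\<^sup>2" using p(1)[OF V(2)] by simp
  have "(\<Sum>i\<in>UNIV. \<Sum>j\<in>UNIV. partial i (flux_coeff E i j) x * partial (base_index j) f u + A i j * H i j)
      / sqrt (det (E x)) \<le> laplace_beltrami E q x"
  proof -
    have "laplace_beltrami E q x = (\<Sum>i\<in>UNIV. \<Sum>j\<in>UNIV. partial i (flux_coeff E i j) x * partial j q x
        + flux_coeff E i j x * partial i (partial j q) x) / sqrt (det (E x))"
      by (rule laplace_beltrami_nondivergence)
        (use Ck1_flux_coeff_2(1)[OF U(1) E spd] Ck2_D(3)[OF q xU] xU in auto)
    moreover have "(\<Sum>i\<in>UNIV. \<Sum>j\<in>UNIV. partial i (flux_coeff E i j) x * partial (base_index j) f u + A i j * H i j)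
      \<le> (\<Sum>i\<in>UNIV. \<Sum>j\<in>UNIV. partial i (flux_coeff E i j) x * partial j q x + A i j * K i j)"
      using trace by (simp add: sum.distrib grad)
    ultimately show ?thesis
      using dpos by (simp add: A_def K_def divide_right_mono)
  qed
  note N = divide_right_mono[OF this less_imp_le[OF pu]]
  have "laplace_beltrami G f u = partial 3 (partial 3 f) u
    + 2 * (partial 3 p u / p u) * partial 3 f u
    + (\<Sum>i\<in>UNIV. \<Sum>j\<in>UNIV. partial i (flux_coeff E i j) x * partial (base_index j) f u + A i j * H i j)
      / sqrt (det (E x)) / (p u)\<^sup>2"
    unfolding A_def H_def x_def
    by (rule laplace_beltrami_warped[where V = V and U = U]) (use V U E spd G p f in auto)
  then show ?thesis
    using vert N by (simp add: x_def)
qed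

section \<open>The radial supersolution near infinity\<close>

lemma integral_bound_by_improper:
  fixes \<phi>b :: "real \<Rightarrow> real"
  assumes int: "(\<lambda>r. 1 / \<phi>b r) integrable_on {0..}" and pos: "\<And>r. 0 \<le> r \<Longrightarrow> 0 < \<phi>b r"
    and "0 \<le> s"
  shows "(\<lambda>r. 1 / \<phi>b r) integrable_on {s..t}"
    and "integral {s..t} (\<lambda>r. 1 / \<phi>b r) \<le> integral {0..} (\<lambda>r. 1 / \<phi>b r)"
proof -
  show 1: "(\<lambda>r. 1 / \<phi>b r) integrable_on {s..t}"
    by (rule integrable_on_subinterval[OF int]) (use assms(3) in auto)
  show "integral {s..t} (\<lambda>r. 1 / \<phi>b r) \<le> integral {0..} (\<lambda>r. 1 / \<phi>b r)"
    by (rule integral_subset_le[OF _ 1 int]) (use assms(3) pos in \<open>auto simp: less_imp_le\<close>)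
qed

text \<open>The witness is \<open>A(r) = \<integral>\<^sub>r\<^sup>\<infinity> s / \<phi>b(s)\<^sup>2 ds\<close>, found by solving
  \<open>(\<phi>b\<^sup>2 A')' = - 1\<close> with \<open>\<phi>b\<^sup>2 A' = - r\<close>.  The integral converges since monotonicity gives
  \<open>(s - r0) / \<phi>b(s) \<le> \<integral> 1/\<phi>b\<close>, so that the integrand is at most a constant times \<open>1/\<phi>b\<close>.\<close>

lemma radial_supersolution_exists:
  fixes \<phi>b :: "real \<Rightarrow> real"
  assumes r0: "0 < r0"
    and diff: "\<phi>b differentiable_on {0..}"
    and pos: "\<And>r. 0 \<le> r \<Longrightarrow> 0 < \<phi>b r"
    and growth: "\<And>r. r0 \<le> r \<Longrightarrow> 0 < deriv \<phi>b r / \<phi>b r"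
    and int: "(\<lambda>r. 1 / \<phi>b r) integrable_on {0..}"
  shows "\<exists>A A' A''. (\<forall>r>r0. (A has_real_derivative A' r) (at r)
            \<and> (A' has_real_derivative A'' r) (at r) \<and> A' r < 0
            \<and> A'' r + 2 * (deriv \<phi>b r / \<phi>b r) * A' r = - 1 / (\<phi>b r)\<^sup>2)
     \<and> continuous_on {r0..} A \<and> (\<forall>r\<ge>r0. 0 < A r) \<and> (A \<longlongrightarrow> 0) at_top
     \<and> (\<forall>r s. r0 \<le> r \<and> r < s \<longrightarrow> A s < A r)"
proof -
  define J where "J = integral {0..} (\<lambda>r. 1 / \<phi>b r)"
  have D: "(\<phi>b has_real_derivative deriv \<phi>b r) (at r)" if "r > 0" for r
  proof -
    have "at r within {0..} = at r"
      by (rule at_within_interior) (use that in auto)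
    then have "\<phi>b differentiable (at r)"
      using diff that unfolding differentiable_on_def by (metis atLeast_iff less_imp_le)
    then show ?thesis
      using DERIV_deriv_iff_real_differentiable by blast
  qed
  have mono: "\<phi>b s \<le> \<phi>b t" if "r0 \<le> s" "s \<le> t" for s t
  proof (rule DERIV_nonneg_imp_nondecreasing[OF that(2)])
    fix r assume r: "s \<le> r" "r \<le> t"
    have "0 < deriv \<phi>b r" using growth[of r] pos[of r] r that r0 by (simp add: zero_less_divide_iff)
    then show "\<exists>y. (\<phi>b has_real_derivative y) (at r) \<and> 0 \<le> y"
      using D[of r] r that r0 by force
  qed
  define K where "K = J + r0 / \<phi>b r0"
  have K: "s / \<phi>b s \<le> K" if s: "r0 \<le> s" for s
  proof -
    have "(s - r0) * (1 / \<phi>b s) = integral {r0..s} (\<lambda>_. 1 / \<phi>b s)" using s by simp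
    also have "\<dots> \<le> integral {r0..s} (\<lambda>r. 1 / \<phi>b r)"
      using integral_bound_by_improper(1)[OF int pos] r0 pos mono
      by (intro integral_le) (auto intro!: divide_left_mono mult_pos_pos)
    also have "\<dots> \<le> J" unfolding J_def
      by (rule integral_bound_by_improper(2)[OF int pos]) (use r0 in auto)
    finally have "(s - r0) / \<phi>b s \<le> J" by simp
    moreover have "r0 / \<phi>b s \<le> r0 / \<phi>b r0"
      using mono[OF order_refl s] pos r0 s by (intro divide_left_mono) auto
    ultimately show ?thesis by (simp add: K_def diff_divide_distrib)
  qed
  define B where "B = (\<lambda>s. s / (\<phi>b s)\<^sup>2)"
  have Bpos: "0 < B s" if "r0 \<le> s" for s using pos[of s] r0 that by (simp add: B_def)
  have Bcont: "continuous_on {r0..} B"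
  proof -
    have "continuous_on {r0..} \<phi>b"
      using differentiable_imp_continuous_on[OF diff] r0 by (meson atLeast_subset_iff continuous_on_subset less_imp_le)
    then show ?thesis unfolding B_def using pos r0
      by (intro continuous_intros) (auto simp: less_le dest: order.trans)
  qed
  have Bint: "B integrable_on {s..t}" if "r0 \<le> s" for s t
    by (rule integrable_continuous_interval, rule continuous_on_subset[OF Bcont]) (use that in auto)
  define P where "P = (\<lambda>r. integral {r0..r} B)"
  have P: "(P has_real_derivative B r) (at r)" if "r0 < r" for r
  proof -
    have "(P has_real_derivative B r) (at r within {r0..r+1})"
      unfolding P_def by (rule integral_has_real_derivative)
        (use that Bcont in \<open>auto intro: continuous_on_subset\<close>)
    moreover have "at r within {r0..r+1} = at r" by (rule at_within_interior) (use that in auto)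
    ultimately show ?thesis by simp
  qed
  have Pcont: "continuous_on {r0..} P"
  proof -
    have "continuous_on {r0..t} P" for t
      unfolding P_def by (rule indefinite_integral_continuous_1) (rule Bint, simp)
    then have "continuous (at r within {r0..}) P" if "r0 \<le> r" for r
    proof -
      have "continuous (at r within {r0..r+1}) P"
        using \<open>continuous_on {r0..r+1} P\<close> that by (auto simp: continuous_on_eq_continuous_within)
      moreover have "at r within {r0..r+1} = at r within {r0..}"
        by (rule at_within_nhd[of r "{..<r+1}"]) auto
      ultimately show ?thesis by simp
    qed
    then show ?thesis by (simp add: continuous_on_eq_continuous_within)
  qed
  have Pmono: "P r < P s" if "r0 \<le> r" "r < s" for r s
  proof (rule DERIV_pos_imp_increasing_open[OF that(2)])
    show "\<exists>y. (P has_real_derivative y) (at x) \<and> 0 < y" if "r < x" "x < s" for x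
      using P[of x] Bpos[of x] that \<open>r0 \<le> r\<close> by force
    show "continuous_on {r..s} P" by (rule continuous_on_subset[OF Pcont]) (use that in auto)
  qed
  have Pbound: "P r \<le> K * J" if "r0 \<le> r" for r
  proof -
    have "P r \<le> integral {r0..r} (\<lambda>s. K * (1 / \<phi>b s))"
      unfolding P_def
    proof (rule integral_le)
      show "B integrable_on {r0..r}" by (rule Bint) simp
      show "(\<lambda>s. K * (1 / \<phi>b s)) integrable_on {r0..r}"
        by (rule integrable_on_mult_right[OF integral_bound_by_improper(1)[OF int pos]]) (use r0 in auto)
      show "B s \<le> K * (1 / \<phi>b s)" if "s \<in> {r0..r}" for s
      proof -
        have "B s = s / \<phi>b s * (1 / \<phi>b s)" by (simp add: B_def power2_eq_square)
        also have "\<dots> \<le> K * (1 / \<phi>b s)"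
          by (rule mult_right_mono[OF K]) (use that r0 pos[of s] in auto)
        finally show ?thesis .
      qed
    qed
    also have "\<dots> = K * integral {r0..r} (\<lambda>s. 1 / \<phi>b s)"
      by (rule integral_mult_right)
    also have "\<dots> \<le> K * J"
    proof (rule mult_left_mono)
      show "integral {r0..r} (\<lambda>s. 1 / \<phi>b s) \<le> J"
        unfolding J_def by (rule integral_bound_by_improper(2)[OF int pos]) (use r0 in auto)
      show "0 \<le> K" using K[of r0] r0 pos[of r0] by (smt (verit) divide_nonneg_pos)
    qed
    finally show ?thesis .
  qed
  (* The tail integral is I - P, where I is the limit of the bounded increasing function P. *)
  define I where "I = (SUP r\<in>{r0..}. P r)"
  have bdd: "bdd_above (P ` {r0..})" using Pbound by (auto intro!: bdd_aboveI)
  have PI: "P r < I" if "r0 \<le> r" for r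
  proof -
    have "P r < P (r + 1)" using Pmono that by simp
    also have "\<dots> \<le> I" unfolding I_def by (rule cSUP_upper[OF _ bdd]) (use that in auto)
    finally show ?thesis .
  qed
  have lim: "(P \<longlongrightarrow> I) at_top"
  proof (rule order_tendstoI)
    fix a assume "a < I"
    then obtain t where t: "r0 \<le> t" "a < P t"
      unfolding I_def using less_cSUP_iff[OF _ bdd, of a] by auto
    have "a < P r" if "t \<le> r" for r
      using Pmono[OF t(1), of r] t(2) that by (cases "t = r") auto
    then show "\<forall>\<^sub>F r in at_top. a < P r" by (auto simp: eventually_at_top_linorder)
  next
    fix a assume "I < a"
    then show "\<forall>\<^sub>F r in at_top. P r < a"
      using PI by (auto simp: eventually_at_top_linorder intro!: exI[of _ r0] dest: less_trans)
  qed
  define A'' where "A'' = (\<lambda>r. - (1 / (\<phi>b r)\<^sup>2 - 2 * r * deriv \<phi>b r / (\<phi>b r)^3))"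
  have "((\<lambda>r. I - P r) has_real_derivative - B r) (at r)
      \<and> ((\<lambda>r. - B r) has_real_derivative A'' r) (at r) \<and> - B r < 0
      \<and> A'' r + 2 * (deriv \<phi>b r / \<phi>b r) * - B r = - 1 / (\<phi>b r)\<^sup>2" if r: "r0 < r" for r
  proof (intro conjI)
    show "((\<lambda>r. I - P r) has_real_derivative - B r) (at r)"
      by (auto intro!: derivative_eq_intros P r)
    have p: "0 < \<phi>b r" using pos r r0 by simp
    have "((\<lambda>r. - (r / (\<phi>b r)\<^sup>2)) has_real_derivative
       - ((1 * (\<phi>b r)\<^sup>2 - r * (2 * (\<phi>b r) * deriv \<phi>b r)) / ((\<phi>b r)\<^sup>2 * (\<phi>b r)\<^sup>2))) (at r)"
      using p D[of r] r r0 by (auto intro!: derivative_eq_intros)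
    moreover have "- ((1 * (\<phi>b r)\<^sup>2 - r * (2 * (\<phi>b r) * deriv \<phi>b r)) / ((\<phi>b r)\<^sup>2 * (\<phi>b r)\<^sup>2)) = A'' r"
      using p by (simp add: A''_def divide_simps power2_eq_square power3_eq_cube) (simp add: algebra_simps)
    ultimately show "((\<lambda>r. - B r) has_real_derivative A'' r) (at r)" by (simp add: B_def)
    show "- B r < 0" using Bpos r by simp
    show "A'' r + 2 * (deriv \<phi>b r / \<phi>b r) * - B r = - 1 / (\<phi>b r)\<^sup>2"
      using p by (simp add: A''_def B_def power2_eq_square power3_eq_cube)
  qed
  moreover have "continuous_on {r0..} (\<lambda>r. I - P r)" by (intro continuous_intros Pcont)
  moreover have "((\<lambda>r. I - P r) \<longlongrightarrow> 0) at_top" using tendsto_diff[OF tendsto_const lim, of I] by simp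
  ultimately show ?thesis
    using PI Pmono
    by (intro exI[of _ "\<lambda>r. I - P r"] exI[of _ "\<lambda>r. - B r"] exI[of _ A'']) auto
qed

section \<open>Charts and the warping function\<close>

lemma chart_properties:
  assumes N: "riemannian_manifold N" and i: "i \<in> idx N"
  shows "openin (pts N) (chart_dom N i)" and "open (chart N i ` chart_dom N i)"
    and "\<omega> \<in> chart_dom N i \<Longrightarrow> chart_inv N i (chart N i \<omega>) = \<omega>"
    and "x \<in> chart N i ` chart_dom N i \<Longrightarrow> chart_inv N i x \<in> chart_dom N i"
    and "x \<in> chart N i ` chart_dom N i \<Longrightarrow> chart N i (chart_inv N i x) = x"
    and "continuous_map (subtopology (pts N) (chart_dom N i)) euclidean (chart N i)"
    and "continuous_map (top_of_set (chart N i ` chart_dom N i)) (pts N) (chart_inv N i)"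
proof -
  let ?d = "chart_dom N i" and ?U = "chart N i ` chart_dom N i"
  have sm: "smooth_manifold N" using N by (simp add: riemannian_manifold_def)
  then have o: "openin (pts N) ?d" "open ?U"
    and hom: "homeomorphic_map (subtopology (pts N) ?d) (top_of_set ?U) (chart N i)"
    using i unfolding smooth_manifold_def by auto
  show "openin (pts N) ?d" "open ?U" using o by auto
  have sub: "?d \<subseteq> topspace (pts N)" using o openin_subset by blast
  have ts: "topspace (subtopology (pts N) ?d) = ?d" using sub by auto
  have inj: "inj_on (chart N i) ?d"
    using homeomorphic_imp_injective_map[OF hom] ts by simp
  show inv: "\<omega> \<in> ?d \<Longrightarrow> chart_inv N i (chart N i \<omega>) = \<omega>" for \<omega>
    unfolding chart_inv_def by (rule inv_into_f_f[OF inj])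
  show im: "x \<in> ?U \<Longrightarrow> chart_inv N i x \<in> ?d" for x
    unfolding chart_inv_def by (rule inv_into_into)
  show inv': "x \<in> ?U \<Longrightarrow> chart N i (chart_inv N i x) = x" for x
    unfolding chart_inv_def by (rule f_inv_into_f)
  have "continuous_map (subtopology (pts N) ?d) (top_of_set ?U) (chart N i)"
    by (rule homeomorphic_imp_continuous_map[OF hom])
  then show "continuous_map (subtopology (pts N) ?d) euclidean (chart N i)"
    using continuous_map_in_subtopology by blast
  obtain g where g: "homeomorphic_maps (subtopology (pts N) ?d) (top_of_set ?U) (chart N i) g"
    using hom homeomorphic_map_maps by blast
  then have gc: "continuous_map (top_of_set ?U) (pts N) g" and gx: "g (chart N i \<omega>) = \<omega>" if "\<omega> \<in> ?d" for \<omega>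
    using that sub unfolding homeomorphic_maps_def by (auto simp: continuous_map_in_subtopology)
  show "continuous_map (top_of_set ?U) (pts N) (chart_inv N i)"
  proof (cases "?d = {}")
    case True then show ?thesis by (simp add: continuous_map_def)
  next
    case False
    then obtain \<omega> where "\<omega> \<in> ?d" by blast
    show ?thesis
      by (rule continuous_map_eq[OF gc[OF \<open>\<omega> \<in> ?d\<close>]]) (auto simp: gx inv)
  qed
qed

lemma metric_properties:
  assumes N: "riemannian_manifold (N :: ('a, 'i, 2) riem)" and i: "i \<in> idx N"
  shows "Ck_on (Suc 0) (chart N i ` chart_dom N i) (metric N i)"
    and "x \<in> chart N i ` chart_dom N i \<Longrightarrow> spd_2 (metric N i x)"
proof -
  have "smooth_on (chart N i ` chart_dom N i) (metric N i)"
    using N i by (simp add: riemannian_manifold_def)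
  then show "Ck_on (Suc 0) (chart N i ` chart_dom N i) (metric N i)"
    by (rule smooth_on_open_imp_Ck1[OF chart_properties(2)[OF N i]])
  show "spd_2 (metric N i x)" if "x \<in> chart N i ` chart_dom N i"
    using N i that by (intro spd_2I) (auto simp: riemannian_manifold_def)
qed

lemma chart_cover:
  assumes "riemannian_manifold N" "\<omega> \<in> topspace (pts N)"
  obtains i where "i \<in> idx N" "\<omega> \<in> chart_dom N i"
  using assms unfolding riemannian_manifold_def smooth_manifold_def by blast

text \<open>Smoothness up to \<open>r = 0\<close> provides an extension \<open>F\<close> across the boundary; at interior points its
  \<open>r\<close>-derivative is the derivative of the warping function, and it stays continuous up to
  \<open>r = 0\<close>.\<close>

lemma warping_smooth_extension:
  assumes N: "riemannian_manifold (N :: ('a, 'i, 2) riem)" and sm: "smooth_on_half_cylinder N \<phi>"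
    and i: "i \<in> idx N" and x: "x0 \<in> chart N i ` chart_dom N i" and s: "0 \<le> s"
  obtains W F where "open W" "(x0, s) \<in> W" "Ck_on (Suc 0) W F"
    "\<And>x r. (x, r) \<in> W \<Longrightarrow> x \<in> chart N i ` chart_dom N i \<Longrightarrow> 0 \<le> r \<Longrightarrow> F (x, r) = \<phi> (chart_inv N i x) r"
    "\<And>x r. (x, r) \<in> W \<Longrightarrow> x \<in> chart N i ` chart_dom N i \<Longrightarrow> 0 < r \<Longrightarrow>
       ((\<lambda>(x, r). \<phi> (chart_inv N i x) r) has_derivative frechet_derivative F (at (x, r))) (at (x, r))"
    "\<And>x r. (x, r) \<in> W \<Longrightarrow> x \<in> chart N i ` chart_dom N i \<Longrightarrow> 0 < r \<Longrightarrow>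
       deriv (\<phi> (chart_inv N i x)) r = frechet_derivative F (at (x, r)) (0, 1)"
proof -
  let ?U = "chart N i ` chart_dom N i"
  have oU: "open ?U" by (rule chart_properties(2)[OF N i])
  obtain W F where W: "open W" "(x0, s) \<in> W" "\<forall>k. Ck_on k W F"
    "\<forall>y\<in>(?U \<times> {0..}) \<inter> W. F y = (\<lambda>(u, r). \<phi> (chart_inv N i u) r) y"
  proof -
    have *: "smooth_on (?U \<times> {0..}) (\<lambda>(u, r). \<phi> (chart_inv N i u) r)"
      using sm i unfolding smooth_on_half_cylinder_def by blast
    have "(x0, s) \<in> ?U \<times> {0..}" using x s by blast
    from bspec[OF *[unfolded smooth_on_def] this] show thesis
      by (elim exE conjE) (rule that)
  qed
  have F1: "Ck_on (Suc 0) W F" using W(3) by blast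
  have eq: "F (x, r) = \<phi> (chart_inv N i x) r" if "(x, r) \<in> W" "x \<in> ?U" "0 \<le> r" for x r
    using bspec[OF W(4), of "(x, r)"] that by simp
  have der: "((\<lambda>(x, r). \<phi> (chart_inv N i x) r) has_derivative frechet_derivative F (at (x, r))) (at (x, r))"
    if "(x, r) \<in> W" "x \<in> ?U" "0 < r" for x r
  proof (rule has_derivative_transform_within_open)
    show "(F has_derivative frechet_derivative F (at (x, r))) (at (x, r))"
      using Ck1_D[OF F1 that(1)] .
    show "open (W \<inter> (?U \<times> {0<..}))" using W(1) oU by (intro open_Int open_Times) auto
    show "(x, r) \<in> W \<inter> (?U \<times> {0<..})" using that by auto
    show "F z = (case z of (x, r) \<Rightarrow> \<phi> (chart_inv N i x) r)" if "z \<in> W \<inter> (?U \<times> {0<..})" for z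
      using that eq by (cases z) auto
  qed
  have der': "deriv (\<phi> (chart_inv N i x)) r = frechet_derivative F (at (x, r)) (0, 1)"
    if "(x, r) \<in> W" "x \<in> ?U" "0 < r" for x r
  proof -
    have lin: "linear (frechet_derivative F (at (x, r)))"
      by (rule has_derivative_linear[OF der[OF that]])
    have "((\<lambda>t. (x, t)) has_derivative (\<lambda>t. (0, t))) (at r)"
      by (rule has_derivative_Pair[OF has_derivative_const has_derivative_ident])
    from has_derivative_compose[OF this der[OF that]]
    have "((\<lambda>t. \<phi> (chart_inv N i x) t) has_derivative (\<lambda>t. frechet_derivative F (at (x, r)) (0, t))) (at r)"
      by simp
    moreover have "(\<lambda>t. frechet_derivative F (at (x, r)) (0, t)) = (*) (frechet_derivative F (at (x, r)) (0, 1))"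
    proof
      show "frechet_derivative F (at (x, r)) (0, t) = frechet_derivative F (at (x, r)) (0, 1) * t" for t
        using linear_scale[OF lin, of t "(0, 1)"] by (simp add: mult.commute)
    qed
    ultimately have "(\<phi> (chart_inv N i x) has_real_derivative frechet_derivative F (at (x, r)) (0, 1)) (at r)"
      unfolding has_field_derivative_def by (simp only:)
    then show ?thesis by (rule DERIV_imp_deriv)
  qed
  show thesis by (rule that[OF W(1,2) F1 eq der der'])
qed

lemma locally_bounded_imp_bounded:
  fixes g :: "'a \<Rightarrow> real"
  assumes X: "compact_space X"
    and loc: "\<And>z. z \<in> topspace X \<Longrightarrow> \<exists>T K. openin X T \<and> z \<in> T \<and> (\<forall>w\<in>T. P w \<longrightarrow> g w \<le> K)"
  shows "\<exists>K. \<forall>w\<in>topspace X. P w \<longrightarrow> g w \<le> K"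
proof -
  have "\<forall>z\<in>topspace X. \<exists>T K. openin X T \<and> z \<in> T \<and> (\<forall>w\<in>T. P w \<longrightarrow> g w \<le> K)"
    using loc by blast
  then obtain T K where TK: "\<And>z. z \<in> topspace X \<Longrightarrow> openin X (T z) \<and> z \<in> T z \<and> (\<forall>w\<in>T z. P w \<longrightarrow> g w \<le> K z)"
    unfolding bchoice_iff by blast
  have "(\<forall>S\<in>T ` topspace X. openin X S) \<and> topspace X \<subseteq> \<Union> (T ` topspace X)"
    using TK by blast
  then obtain \<F> where "finite \<F>" "\<F> \<subseteq> T ` topspace X" "topspace X \<subseteq> \<Union> \<F>"
    using X unfolding compact_space_alt by meson
  then obtain Z where Z: "finite Z" "Z \<subseteq> topspace X" "topspace X \<subseteq> \<Union> (T ` Z)"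
    by (metis finite_subset_image)
  have "g w \<le> (\<Sum>z\<in>Z. \<bar>K z\<bar>)" if w: "w \<in> topspace X" "P w" for w
  proof -
    obtain z where z: "z \<in> Z" "w \<in> T z" using Z(3) w(1) by blast
    then have "g w \<le> \<bar>K z\<bar>" using TK[of z] Z(2) w(2) by force
    also have "\<dots> \<le> (\<Sum>z\<in>Z. \<bar>K z\<bar>)" by (rule member_le_sum) (use z Z in auto)
    finally show ?thesis .
  qed
  then show ?thesis by blast
qed

text \<open>The logarithmic derivative of the local extensions is continuous, hence locally bounded, near
  all points of the compact set \<open>N \<times> {0..R}\<close>, those with \<open>r = 0\<close> included.\<close>

lemma log_derivative_bounded_below:
  assumes N: "riemannian_manifold (N :: ('a, 'i, 2) riem)" and cpt: "compact_space (pts N)"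
    and sm: "smooth_on_half_cylinder N \<phi>"
    and pos: "\<And>\<omega> r. \<omega> \<in> topspace (pts N) \<Longrightarrow> 0 \<le> r \<Longrightarrow> 0 < \<phi> \<omega> r"
  shows "\<exists>M. \<forall>\<omega>\<in>topspace (pts N). \<forall>r. 0 < r \<and> r \<le> R \<longrightarrow> - M \<le> deriv (\<phi> \<omega>) r / \<phi> \<omega> r"
proof -
  define X where "X = prod_topology (pts N) (top_of_set {0..R})"
  have tX: "topspace X = topspace (pts N) \<times> {0..R}" by (simp add: X_def)
  have "compact_space X"
    unfolding X_def compact_space_prod_topology using cpt by (simp add: compact_space_subtopology)
  moreover have "\<exists>T K. openin X T \<and> z \<in> T \<and>
      (\<forall>w\<in>T. 0 < snd w \<longrightarrow> - (deriv (\<phi> (fst w)) (snd w) / \<phi> (fst w) (snd w)) \<le> K)"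
    if "z \<in> topspace X" for z
  proof -
    obtain \<omega>0 s where z: "z = (\<omega>0, s)" by (cases z)
    then have w0: "\<omega>0 \<in> topspace (pts N)" and s: "0 \<le> s" "s \<le> R" using that tX by auto
    obtain i where i: "i \<in> idx N" "\<omega>0 \<in> chart_dom N i" using chart_cover[OF N w0] .
    let ?U = "chart N i ` chart_dom N i"
    note ch = chart_properties[OF N i(1)]
    have x0: "chart N i \<omega>0 \<in> ?U" using i by blast
    obtain W F where W: "open W" "(chart N i \<omega>0, s) \<in> W" "Ck_on (Suc 0) W F"
      "\<And>x r. (x, r) \<in> W \<Longrightarrow> x \<in> ?U \<Longrightarrow> 0 \<le> r \<Longrightarrow> F (x, r) = \<phi> (chart_inv N i x) r"
      "\<And>x r. (x, r) \<in> W \<Longrightarrow> x \<in> ?U \<Longrightarrow> 0 < r \<Longrightarrow>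
         ((\<lambda>(x, r). \<phi> (chart_inv N i x) r) has_derivative frechet_derivative F (at (x, r))) (at (x, r))"
      "\<And>x r. (x, r) \<in> W \<Longrightarrow> x \<in> ?U \<Longrightarrow> 0 < r \<Longrightarrow>
         deriv (\<phi> (chart_inv N i x)) r = frechet_derivative F (at (x, r)) (0, 1)"
      by (rule warping_smooth_extension[OF N sm i(1) x0 s(1)]) (rule that)
    define \<rho> where "\<rho> = (\<lambda>y. - (frechet_derivative F (at y) (0, 1) / F y))"
    let ?y = "(chart N i \<omega>0, s)"
    have Fp: "F ?y \<noteq> 0"
      using W(4)[OF W(2) x0 s(1)] ch(3)[OF i(2)] pos[OF w0 s(1)] by simp
    have "(0, 1) \<in> (Basis :: ((real^2) \<times> real) set)" by (simp add: Basis_prod_def)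
    then have "continuous_on W (\<lambda>y. frechet_derivative F (at y) (0, 1))"
      using W(3) unfolding Ck1_iff by blast
    then have "isCont \<rho> ?y"
      unfolding \<rho>_def using Ck1_imp_continuous_on[OF W(3)] W(1,2) Fp
      by (intro continuous_intros) (auto simp: continuous_on_eq_continuous_at)
    then have "\<forall>\<^sub>F y in nhds ?y. \<rho> y < \<rho> ?y + 1"
      by (intro order_tendstoD(2)) (auto simp: isCont_def tendsto_at_iff_tendsto_nhds)
    then obtain W' where W': "open W'" "?y \<in> W'" "\<And>y. y \<in> W' \<Longrightarrow> \<rho> y < \<rho> ?y + 1"
      unfolding eventually_nhds by blast
    define T where "T = {w \<in> chart_dom N i \<times> {0..R}. (chart N i (fst w), snd w) \<in> W \<inter> W'}"
    have dX: "openin X (chart_dom N i \<times> {0..R})"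
      unfolding X_def openin_prod_Times_iff using ch(1) by simp
    have sX: "subtopology X (chart_dom N i \<times> {0..R}) = prod_topology (subtopology (pts N) (chart_dom N i)) (top_of_set {0..R})"
      unfolding X_def by (simp add: subtopology_Times subtopology_subtopology)
    have "continuous_map (subtopology X (chart_dom N i \<times> {0..R})) euclidean (\<lambda>w. (chart N i (fst w), snd w))"
      unfolding sX prod_topology_euclidean[symmetric]
      by (intro continuous_map_pairedI continuous_map_into_fulltopology[OF continuous_map_snd]
          continuous_map_compose[of _ _ fst, unfolded o_def, OF continuous_map_fst ch(6)])
    moreover have "openin euclidean (W \<inter> W')" using W(1) W'(1) by auto
    ultimately have "openin (subtopology X (chart_dom N i \<times> {0..R}))
        {w \<in> topspace (subtopology X (chart_dom N i \<times> {0..R})). (chart N i (fst w), snd w) \<in> W \<inter> W'}"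
      by (rule openin_continuous_map_preimage)
    moreover have "{w \<in> topspace (subtopology X (chart_dom N i \<times> {0..R})). (chart N i (fst w), snd w) \<in> W \<inter> W'} = T"
      using openin_subset[OF dX] unfolding T_def topspace_subtopology by blast
    ultimately have "openin (subtopology X (chart_dom N i \<times> {0..R})) T" by simp
    then have oT: "openin X T" using openin_open_subtopology[OF dX] by blast
    have zT: "z \<in> T" using z i s W(2) W'(2) by (auto simp: T_def)
    have "- (deriv (\<phi> (fst w)) (snd w) / \<phi> (fst w) (snd w)) \<le> \<rho> ?y + 1" if w: "w \<in> T" "0 < snd w" for w
    proof -
      obtain \<omega> r where wr: "w = (\<omega>, r)" by (cases w)
      have *: "\<omega> \<in> chart_dom N i" "(chart N i \<omega>, r) \<in> W" "(chart N i \<omega>, r) \<in> W'" "0 < r"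
        using w by (auto simp: T_def wr)
      have "chart N i \<omega> \<in> ?U" using *(1) by blast
      then have "\<rho> (chart N i \<omega>, r) = - (deriv (\<phi> \<omega>) r / \<phi> \<omega> r)"
        using W(4)[OF *(2)] W(6)[OF *(2)] *(4) ch(3)[OF *(1)] by (simp add: \<rho>_def)
      then show ?thesis using W'(3)[OF *(3)] by (simp add: wr)
    qed
    then show ?thesis using oT zT by blast
  qed
  ultimately obtain K where "\<forall>w\<in>topspace X. 0 < snd w \<longrightarrow> - (deriv (\<phi> (fst w)) (snd w) / \<phi> (fst w) (snd w)) \<le> K"
    using locally_bounded_imp_bounded[of X "\<lambda>w. 0 < snd w" "\<lambda>w. - (deriv (\<phi> (fst w)) (snd w) / \<phi> (fst w) (snd w))"]
    by blast
  then show ?thesis by (intro exI[of _ K]) (force simp: tX)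
qed

section \<open>A criterion for superharmonicity\<close>

lemma warped_cylinder_simps [simp]:
  "pts (warped_cylinder N \<phi>) = prod_topology (pts N) (top_of_set {0<..})"
  "idx (warped_cylinder N \<phi>) = idx N"
  "chart_dom (warped_cylinder N \<phi>) i = chart_dom N i \<times> {0<..}"
  "chart (warped_cylinder N \<phi>) i (\<omega>, r) = vector [chart N i \<omega> $ 1, chart N i \<omega> $ 2, r]"
  "metric (warped_cylinder N \<phi>) i u =
     warped_matrix ((\<phi> (chart_inv N i (base_coords u)) (u $ 3))\<^sup>2) (metric N i (base_coords u))"
  by (simp_all add: warped_cylinder_def warped_matrix_def base_coords_def Let_def)

lemma base_coords_vector [simp]: "base_coords (vector [x $ 1, x $ 2, r]) = x"
  by (simp add: base_coords_def vec_eq_iff forall_2)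

lemma chart_inv_warped_cylinder:
  assumes N: "riemannian_manifold (N :: ('a, 'i, 2) riem)" and i: "i \<in> idx N"
    and v: "base_coords v \<in> chart N i ` chart_dom N i" "0 < v $ 3"
  shows "chart_inv (warped_cylinder N \<phi>) i v = (chart_inv N i (base_coords v), v $ 3)"
    and "v = chart (warped_cylinder N \<phi>) i (chart_inv N i (base_coords v), v $ 3)"
proof -
  note ch = chart_properties[OF N i]
  have veq: "v = vector [chart N i \<omega> $ 1, chart N i \<omega> $ 2, v $ 3]" if "chart N i \<omega> = base_coords v" for \<omega>
    using that by (simp add: vec_eq_iff forall_3)
  show v_eq: "v = chart (warped_cylinder N \<phi>) i (chart_inv N i (base_coords v), v $ 3)"
    using veq[OF ch(5)[OF v(1)]] by simp
  have inj: "inj_on (chart (warped_cylinder N \<phi>) i) (chart_dom (warped_cylinder N \<phi>) i)"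
  proof (rule inj_onI, clarsimp)
    fix \<omega> r \<omega>' r'
    assume *: "\<omega> \<in> chart_dom N i" "\<omega>' \<in> chart_dom N i"
      "vector [chart N i \<omega> $ 1, chart N i \<omega> $ 2, r] = (vector [chart N i \<omega>' $ 1, chart N i \<omega>' $ 2, r'] :: real^3)"
    have "chart N i \<omega> = chart N i \<omega>'" using arg_cong[OF *(3), of base_coords] by simp
    moreover have "r = r'" using arg_cong[OF *(3), of "\<lambda>v. v $ 3"] by simp
    ultimately show "\<omega> = \<omega>' \<and> r = r'" using ch(3)[OF *(1)] ch(3)[OF *(2)] by metis
  qed
  have mem: "(chart_inv N i (base_coords v), v $ 3) \<in> chart_dom (warped_cylinder N \<phi>) i"
    using ch(4)[OF v(1)] v(2) by simp
  have "chart_inv (warped_cylinder N \<phi>) i (chart (warped_cylinder N \<phi>) i (chart_inv N i (base_coords v), v $ 3))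
      = (chart_inv N i (base_coords v), v $ 3)"
    unfolding chart_inv_def[of "warped_cylinder N \<phi>"] by (rule inv_into_f_f[OF inj mem])
  then show "chart_inv (warped_cylinder N \<phi>) i v = (chart_inv N i (base_coords v), v $ 3)"
    using v_eq by simp
qed

text \<open>The pointwise comparison carried over from coordinates to the cylinder.  The chart \<open>i\<close> is
  arbitrary among those around the point, so \<open>q\<close> can be given in whichever chart is convenient
  and never has to be transformed.\<close>

lemma harmonic_max_condition:
  assumes N: "riemannian_manifold (N :: ('a, 'i, 2) riem)" and sm: "smooth_on_half_cylinder N \<phi>"
    and pos: "\<And>\<omega> r. \<omega> \<in> topspace (pts N) \<Longrightarrow> 0 \<le> r \<Longrightarrow> 0 < \<phi> \<omega> r"
    and i: "i \<in> idx N" and w0: "\<omega>0 \<in> chart_dom N i" and s: "0 < s"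
    and harm: "harmonic_on (warped_cylinder N \<phi>) \<Omega> h"
    and T: "openin (pts (warped_cylinder N \<phi>)) T" "(\<omega>0, s) \<in> T" "T \<subseteq> \<Omega>"
    and q: "Ck_on 2 (chart N i ` chart_dom N i) q"
    and a: "\<forall>\<^sub>F r in nhds s. (a has_real_derivative a' r) (at r)" "(a' has_real_derivative a'') (at s)"
    and max: "\<And>\<omega> r. (\<omega>, r) \<in> T \<Longrightarrow> \<omega> \<in> chart_dom N i \<Longrightarrow>
      h (\<omega>, r) - (q (chart N i \<omega>) + a r) \<le> h (\<omega>0, s) - (q (chart N i \<omega>0) + a s)"
  shows "0 \<le> a'' + 2 * (deriv (\<phi> \<omega>0) s / \<phi> \<omega>0 s) * a' s
    + laplace_beltrami (metric N i) q (chart N i \<omega>0) / (\<phi> \<omega>0 s)\<^sup>2"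
proof -
  let ?U = "chart N i ` chart_dom N i" and ?M = "warped_cylinder N \<phi>"
  note ch = chart_properties[OF N i] and inv = chart_inv_warped_cylinder[OF N i]
  define u :: "real^3" where "u = vector [chart N i \<omega>0 $ 1, chart N i \<omega>0 $ 2, s]"
  have u: "base_coords u = chart N i \<omega>0" "u $ 3 = s" by (simp_all add: u_def)
  have x0: "chart N i \<omega>0 \<in> ?U" using w0 by blast
  define p where "p = (\<lambda>v :: real^3. \<phi> (chart_inv N i (base_coords v)) (v $ 3))"
  (* The image of T in the chart. *)
  define V where "V = {v. base_coords v \<in> ?U \<and> 0 < v $ 3 \<and> (chart_inv N i (base_coords v), v $ 3) \<in> T}"
  have oV: "open V"
  proof -
    define V0 where "V0 = {v :: real^3. base_coords v \<in> ?U \<and> 0 < v $ 3}"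
    have "open (base_coords -` ?U)"
      by (rule open_vimage[OF ch(2)]) (rule linear_continuous_on[OF bounded_linear_base_coords])
    moreover have "open ((\<lambda>v :: real^3. v $ 3) -` {0<..})"
      by (rule open_vimage) (auto intro!: continuous_intros)
    moreover have "V0 = base_coords -` ?U \<inter> (\<lambda>v :: real^3. v $ 3) -` {0<..}" by (auto simp: V0_def)
    ultimately have oV0: "open V0" by auto
    have "continuous_map (top_of_set V0) (top_of_set ?U) base_coords"
      using linear_continuous_on[OF bounded_linear_base_coords] by (auto simp: V0_def continuous_map_in_subtopology)
    from continuous_map_compose[OF this ch(7)]
    have "continuous_map (top_of_set V0) (pts ?M) (\<lambda>v. (chart_inv N i (base_coords v), v $ 3))"
      unfolding warped_cylinder_simps
      by (intro continuous_map_pairedI)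
        (auto simp: o_def V0_def continuous_map_in_subtopology intro!: continuous_intros)
    from openin_continuous_map_preimage[OF this T(1)]
    have "openin (top_of_set V0) V" by (rule back_subst[of "openin _"]) (auto simp: V_def V0_def)
    then show ?thesis using oV0 openin_open_trans by blast
  qed
  have uV: "u \<in> V" using x0 s T(2) ch(3)[OF w0] by (simp add: V_def u)
  have sub: "V \<subseteq> chart ?M i ` (chart_dom ?M i \<inter> \<Omega>)"
  proof
    fix v assume "v \<in> V"
    then have v: "base_coords v \<in> ?U" "0 < v $ 3" "(chart_inv N i (base_coords v), v $ 3) \<in> \<Omega>"
      using T(3) by (auto simp: V_def)
    have "v = chart ?M i (chart_inv N i (base_coords v), v $ 3)" by (rule inv(2)[OF v(1,2)])
    moreover have "(chart_inv N i (base_coords v), v $ 3) \<in> chart_dom ?M i \<inter> \<Omega>"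
      using v ch(4)[OF v(1)] by simp
    ultimately show "v \<in> chart ?M i ` (chart_dom ?M i \<inter> \<Omega>)" by (rule image_eqI)
  qed
  define f where "f = h \<circ> chart_inv ?M i"
  have fv: "f v = h (chart_inv N i (base_coords v), v $ 3)" if "v \<in> V" for v
    using that inv(1) by (simp add: f_def V_def)
  have "i \<in> idx ?M" using i by simp
  from bspec[OF harm[unfolded harmonic_on_def Let_def] this]
  have f0: "Ck_on 2 (chart ?M i ` (chart_dom ?M i \<inter> \<Omega>)) f"
    and lap0: "\<forall>u\<in>chart ?M i ` (chart_dom ?M i \<inter> \<Omega>). laplace_beltrami (metric ?M i) f u = 0"
    unfolding f_def by (rule conjunct1, rule conjunct2)
  have f: "Ck_on 2 V f" by (rule Ck2_subset[OF f0 sub])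
  have lap: "laplace_beltrami (metric ?M i) f u = 0" by (rule bspec[OF lap0 subsetD[OF sub uV]])
  obtain W F where W: "open W" "(chart N i \<omega>0, s) \<in> W" "Ck_on (Suc 0) W F"
    "\<And>x r. (x, r) \<in> W \<Longrightarrow> x \<in> ?U \<Longrightarrow> 0 \<le> r \<Longrightarrow> F (x, r) = \<phi> (chart_inv N i x) r"
    "\<And>x r. (x, r) \<in> W \<Longrightarrow> x \<in> ?U \<Longrightarrow> 0 < r \<Longrightarrow>
       ((\<lambda>(x, r). \<phi> (chart_inv N i x) r) has_derivative frechet_derivative F (at (x, r))) (at (x, r))"
    "\<And>x r. (x, r) \<in> W \<Longrightarrow> x \<in> ?U \<Longrightarrow> 0 < r \<Longrightarrow>
       deriv (\<phi> (chart_inv N i x)) r = frechet_derivative F (at (x, r)) (0, 1)"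
    by (rule warping_smooth_extension[OF N sm i x0 less_imp_le[OF s]]) (rule that)
  note der = W(5)[OF W(2) x0 s] and der' = W(6)[OF W(2) x0 s]
  have lin: "((\<lambda>v :: real^3. (base_coords v, v $ 3)) has_derivative (\<lambda>d. (base_coords d, d $ 3))) (at u)"
    by (intro has_derivative_Pair bounded_linear_imp_has_derivative bounded_linear_base_coords bounded_linear_vec_nth)
  have "((\<lambda>(x, r). \<phi> (chart_inv N i x) r) has_derivative frechet_derivative F (at (chart N i \<omega>0, s)))
      (at (base_coords u, u $ 3))"
    using der by (simp add: u)
  from has_derivative_compose[OF lin this]
  have pder: "(p has_derivative (\<lambda>d. frechet_derivative F (at (chart N i \<omega>0, s)) (base_coords d, d $ 3))) (at u)"
    by (simp add: p_def)
  have p3: "partial 3 p u = deriv (\<phi> \<omega>0) s"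
    using partial_eqI[OF pder, of 3] der' ch(3)[OF w0] by simp
  have pu: "p u = \<phi> \<omega>0 s" using ch(3)[OF w0] by (simp add: p_def u)
  have "laplace_beltrami (metric ?M i) f u \<le> a'' + 2 * (partial 3 p u / p u) * a' (u $ 3)
      + laplace_beltrami (metric N i) q (base_coords u) / (p u)\<^sup>2"
  proof (rule laplace_beltrami_le_at_touching_point[where V = V and U = ?U and a = a])
    show "open V" "u \<in> V" "open ?U" by (rule oV uV ch(2))+
    show "base_coords v \<in> ?U" if "v \<in> V" for v using that by (simp add: V_def)
    show "Ck_on (Suc 0) ?U (metric N i)" by (rule metric_properties(1)[OF N i])
    show "spd_2 (metric N i x)" if "x \<in> ?U" for x by (rule metric_properties(2)[OF N i that])
    show "metric ?M i v = warped_matrix ((p v)\<^sup>2) (metric N i (base_coords v))" if "v \<in> V" for v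
      by (simp add: p_def)
    show "0 < p v" if "v \<in> V" for v
    proof -
      have "chart_inv N i (base_coords v) \<in> topspace (pts N)"
        using that ch(4)[of "base_coords v"] openin_subset[OF ch(1)] by (auto simp: V_def)
      then show ?thesis using that pos by (simp add: p_def V_def)
    qed
    show "p differentiable (at u)" using pder unfolding differentiable_def by blast
    show "Ck_on 2 V f" "Ck_on 2 ?U q" by (rule f q)+
    show "\<forall>\<^sub>F r in nhds (u $ 3). (a has_real_derivative a' r) (at r)" "(a' has_real_derivative a'') (at (u $ 3))"
      using a by (simp_all add: u)
    show "\<forall>\<^sub>F v in nhds u. f v - (q (base_coords v) + a (v $ 3)) \<le> f u - (q (base_coords u) + a (u $ 3))"
      using eventually_nhds_in_open[OF oV uV]
    proof eventually_elim
      case (elim v)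
      then have v: "base_coords v \<in> ?U" "(chart_inv N i (base_coords v), v $ 3) \<in> T" by (auto simp: V_def)
      from max[OF v(2) ch(4)[OF v(1)]] show ?case
        using fv[OF elim] fv[OF uV] ch(3)[OF w0] ch(5)[OF v(1)] by (simp add: u)
    qed
  qed
  then show ?thesis unfolding lap p3 pu u .
qed

text \<open>A supersolution property in the viscosity sense: a minimum of functions has it as soon as
  each of them has negative Laplacian where it attains the minimum.\<close>

definition touched_by_strict_supersolution ::
    "('a, 'i, 2) riem \<Rightarrow> ('a \<Rightarrow> real \<Rightarrow> real) \<Rightarrow> ('a \<times> real \<Rightarrow> real) \<Rightarrow> 'a \<Rightarrow> real \<Rightarrow> bool" where
  "touched_by_strict_supersolution N \<phi> v \<omega>0 s \<longleftrightarrow>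
     (\<exists>i q a a' a'' T. i \<in> idx N \<and> \<omega>0 \<in> chart_dom N i \<and> Ck_on 2 (chart N i ` chart_dom N i) q
        \<and> (\<forall>\<^sub>F r in nhds s. (a has_real_derivative a' r) (at r)) \<and> (a' has_real_derivative a'') (at s)
        \<and> openin (pts (warped_cylinder N \<phi>)) T \<and> (\<omega>0, s) \<in> T
        \<and> (\<forall>(\<omega>, r)\<in>T. \<omega> \<in> chart_dom N i \<longrightarrow> v (\<omega>, r) \<le> q (chart N i \<omega>) + a r)
        \<and> v (\<omega>0, s) = q (chart N i \<omega>0) + a s
        \<and> a'' + 2 * (deriv (\<phi> \<omega>0) s / \<phi> \<omega>0 s) * a' s
            + laplace_beltrami (metric N i) q (chart N i \<omega>0) / (\<phi> \<omega>0 s)\<^sup>2 < 0)"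

lemma touched_by_strict_supersolutionI:
  assumes "i \<in> idx N" "\<omega>0 \<in> chart_dom N i" "Ck_on 2 (chart N i ` chart_dom N i) q"
    and "\<forall>\<^sub>F r in nhds s. (a has_real_derivative a' r) (at r)" "(a' has_real_derivative a'') (at s)"
    and "openin (pts (warped_cylinder N \<phi>)) T" "(\<omega>0, s) \<in> T"
    and "\<And>\<omega> r. (\<omega>, r) \<in> T \<Longrightarrow> \<omega> \<in> chart_dom N i \<Longrightarrow> v (\<omega>, r) \<le> q (chart N i \<omega>) + a r"
    and "v (\<omega>0, s) = q (chart N i \<omega>0) + a s"
    and "a'' + 2 * (deriv (\<phi> \<omega>0) s / \<phi> \<omega>0 s) * a' s
            + laplace_beltrami (metric N i) q (chart N i \<omega>0) / (\<phi> \<omega>0 s)\<^sup>2 < 0"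
  shows "touched_by_strict_supersolution N \<phi> v \<omega>0 s"
  unfolding touched_by_strict_supersolution_def
  by (rule exI[of _ i], rule exI[of _ q], rule exI[of _ a], rule exI[of _ a'], rule exI[of _ a''],
      rule exI[of _ T], intro conjI) (use assms in auto)

text \<open>Where \<open>h - v\<close> is maximal, \<open>h\<close> minus the touching function has a local maximum too,
  so the strictly negative Laplacian of the touching function contradicts the second-derivative
  test.\<close>

lemma superharmonicI_touching:
  assumes N: "riemannian_manifold (N :: ('a, 'i, 2) riem)" and sm: "smooth_on_half_cylinder N \<phi>"
    and pos: "\<And>\<omega> r. \<omega> \<in> topspace (pts N) \<Longrightarrow> 0 \<le> r \<Longrightarrow> 0 < \<phi> \<omega> r"
    and cont: "continuous_map (pts (warped_cylinder N \<phi>)) euclideanreal v"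
    and touch: "\<And>\<omega> r. \<omega> \<in> topspace (pts N) \<Longrightarrow> 0 < r \<Longrightarrow> touched_by_strict_supersolution N \<phi> v \<omega> r"
  shows "superharmonic (warped_cylinder N \<phi>) v"
  unfolding superharmonic_def
proof (intro conjI allI impI ballI cont, elim conjE)
  let ?X = "pts (warped_cylinder N \<phi>)"
  fix \<Omega> h z
  assume o: "openin ?X \<Omega>" and cpt: "compactin ?X (?X closure_of \<Omega>)"
    and hc: "continuous_map (subtopology ?X (?X closure_of \<Omega>)) euclideanreal h"
    and harm: "harmonic_on (warped_cylinder N \<phi>) \<Omega> h"
    and bd: "\<forall>z\<in>?X frontier_of \<Omega>. h z = v z" and z: "z \<in> \<Omega>"
  let ?C = "?X closure_of \<Omega>"
  have \<Omega>C: "\<Omega> \<subseteq> ?C" by (rule closure_of_subset[OF openin_subset[OF o]])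
  show "h z \<le> v z"
  proof (rule ccontr)
    assume "\<not> h z \<le> v z"
    have "continuous_map (subtopology ?X ?C) euclideanreal (\<lambda>z. h z - v z)"
      by (intro continuous_map_diff hc continuous_map_from_subtopology cont)
    moreover have "compactin (subtopology ?X ?C) ?C" using cpt by (simp add: compactin_subtopology)
    ultimately have "compactin euclideanreal ((\<lambda>z. h z - v z) ` ?C)" by (rule image_compactin[rotated])
    then have "compact ((\<lambda>z. h z - v z) ` ?C)" by simp
    moreover have "(\<lambda>z. h z - v z) ` ?C \<noteq> {}" using z \<Omega>C by blast
    ultimately obtain y where y: "y \<in> ?C" "\<And>w. w \<in> ?C \<Longrightarrow> h w - v w \<le> h y - v y"
      using compact_attains_sup[of "(\<lambda>z. h z - v z) ` ?C"] by blast
    have "h y - v y > 0" using y(2)[of z] z \<Omega>C \<open>\<not> h z \<le> v z\<close> by force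
    then have "y \<notin> ?X frontier_of \<Omega>" using bd by force
    then have y\<Omega>: "y \<in> \<Omega>" using y(1) o by (simp add: frontier_of_def interior_of_openin)
    obtain \<omega>0 s where ys: "y = (\<omega>0, s)" by (cases y)
    have top: "\<omega>0 \<in> topspace (pts N)" "0 < s"
      using openin_subset[OF o] y\<Omega> by (auto simp: ys)
    from touch[OF this] obtain i q a a' a'' T where t: "i \<in> idx N" "\<omega>0 \<in> chart_dom N i"
        "Ck_on 2 (chart N i ` chart_dom N i) q"
        "\<forall>\<^sub>F r in nhds s. (a has_real_derivative a' r) (at r)" "(a' has_real_derivative a'') (at s)"
        "openin ?X T" "(\<omega>0, s) \<in> T"
        "\<forall>(\<omega>, r)\<in>T. \<omega> \<in> chart_dom N i \<longrightarrow> v (\<omega>, r) \<le> q (chart N i \<omega>) + a r"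
        "v (\<omega>0, s) = q (chart N i \<omega>0) + a s"
        "a'' + 2 * (deriv (\<phi> \<omega>0) s / \<phi> \<omega>0 s) * a' s
            + laplace_beltrami (metric N i) q (chart N i \<omega>0) / (\<phi> \<omega>0 s)\<^sup>2 < 0"
      unfolding touched_by_strict_supersolution_def by blast
    have "0 \<le> a'' + 2 * (deriv (\<phi> \<omega>0) s / \<phi> \<omega>0 s) * a' s
            + laplace_beltrami (metric N i) q (chart N i \<omega>0) / (\<phi> \<omega>0 s)\<^sup>2"
    proof (rule harmonic_max_condition[OF N sm pos t(1,2) top(2) harm])
      show "openin ?X (T \<inter> \<Omega>)" using t(6) o by (rule openin_Int)
      show "(\<omega>0, s) \<in> T \<inter> \<Omega>" using t(7) y\<Omega> ys by simp
      show "h (\<omega>, r) - (q (chart N i \<omega>) + a r) \<le> h (\<omega>0, s) - (q (chart N i \<omega>0) + a s)"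
        if "(\<omega>, r) \<in> T \<inter> \<Omega>" "\<omega> \<in> chart_dom N i" for \<omega> r
      proof -
        have "v (\<omega>, r) \<le> q (chart N i \<omega>) + a r" using t(8) that by blast
        moreover have "h (\<omega>, r) - v (\<omega>, r) \<le> h (\<omega>0, s) - v (\<omega>0, s)"
          using y(2)[of "(\<omega>, r)"] that \<Omega>C ys by auto
        ultimately show ?thesis using t(9) by linarith
      qed
    qed (use t in auto)
    with t(10) show False by linarith
  qed
qed

section \<open>The barrier\<close>

lemma continuous_on_ennreal_extension:
  fixes g :: "real \<Rightarrow> real"
  assumes g: "continuous_on {0..} g" and lim: "(g \<longlongrightarrow> l) at_top"
  shows "continuous_on UNIV (\<lambda>t::ennreal. if t = top then l else g (enn2real t))"
proof -
  have "isCont (\<lambda>t::ennreal. if t = top then l else g (enn2real t)) t" for t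
  proof (cases "t = top")
    case False
    then obtain r where r: "t = ennreal r" "0 \<le> r" by (cases t) auto
    have "((\<lambda>t. enn2real t) \<longlongrightarrow> r) (nhds t)"
      by (rule tendsto_enn2real) (use r filterlim_ident in auto)
    moreover have "\<forall>\<^sub>F t in nhds t. enn2real t \<in> {0..}" by simp
    moreover have "(g \<longlongrightarrow> g r) (at r within {0..})" using g r(2) by (simp add: continuous_on_def)
    ultimately have "((\<lambda>t. g (enn2real t)) \<longlongrightarrow> g r) (nhds t)"
      using g r(2) by (intro continuous_on_tendsto_compose[OF g]) auto
    moreover have "\<forall>\<^sub>F t in nhds t. t \<in> {..<top}"
      by (rule eventually_nhds_in_open) (use False in \<open>auto simp: less_top\<close>)
    then have "\<forall>\<^sub>F t in nhds t. g (enn2real t) = (if t = top then l else g (enn2real t))"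
      by eventually_elim auto
    ultimately have "((\<lambda>t. if t = top then l else g (enn2real t)) \<longlongrightarrow> g r) (nhds t)"
      by (rule Lim_transform_eventually)
    then show ?thesis using False r tendsto_mono[OF at_within_le_nhds] by (auto simp: isCont_def)
  next
    case True
    have "((\<lambda>t. if t = top then l else g (enn2real t)) \<longlongrightarrow> l) (nhds top)"
    proof (rule tendstoI)
      fix e :: real assume "0 < e"
      then obtain R where R: "\<And>r. R \<le> r \<Longrightarrow> dist (g r) l < e"
        using tendstoD[OF lim] unfolding eventually_at_top_linorder by blast
      have "\<forall>\<^sub>F t in nhds top. t \<in> {ennreal (max R 0)<..}"
        by (rule eventually_nhds_in_open) auto
      then show "\<forall>\<^sub>F t in nhds top. dist (if t = top then l else g (enn2real t)) l < e"
      proof eventually_elim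
        case (elim t)
        show ?case
        proof (cases "t = top")
          case False
          then obtain r where r: "t = ennreal r" "0 \<le> r" by (cases t) auto
          then have "R \<le> r" using elim by (simp add: ennreal_less_iff)
          then show ?thesis using R r False by simp
        qed (use \<open>0 < e\<close> in simp)
      qed
    qed
    then show ?thesis using True tendsto_mono[OF at_within_le_nhds] by (auto simp: isCont_def)
  qed
  then show ?thesis by (simp add: continuous_on_eq_continuous_at)
qed

text \<open>The truncation is constant off the preimage of the closed ball, which is compact and hence
  closed in the Hausdorff space \<open>N\<close>; this and the chart domain give two open sets on which
  continuity is clear.\<close>

lemma truncated_square_distance_continuous:
  assumes N: "riemannian_manifold (N :: ('a, 'i, 2) riem)" and i: "i \<in> idx N"
    and ball: "cball x0 \<rho> \<subseteq> chart N i ` chart_dom N i" and \<rho>: "0 \<le> \<rho>"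
  shows "continuous_map (pts N) euclideanreal
    (\<lambda>\<omega>. if \<omega> \<in> chart_dom N i then min ((dist x0 (chart N i \<omega>))\<^sup>2) (\<rho>\<^sup>2) else \<rho>\<^sup>2)"
proof -
  note ch = chart_properties[OF N i]
  define K where "K = chart_inv N i ` cball x0 \<rho>"
  have "compactin (pts N) K"
    unfolding K_def
  proof (rule image_compactin)
    show "compactin (top_of_set (chart N i ` chart_dom N i)) (cball x0 \<rho>)"
      using ball by (simp add: compactin_subtopology)
  qed (rule ch(7))
  moreover have "Hausdorff_space (pts N)"
    using N by (simp add: riemannian_manifold_def smooth_manifold_def)
  ultimately have "closedin (pts N) K" by (rule compactin_imp_closedin[rotated])
  then have oK: "openin (pts N) (topspace (pts N) - K)" by blast
  have Kd: "K \<subseteq> chart_dom N i" using ball ch(4) by (auto simp: K_def)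
  have out: "\<rho> < dist x0 (chart N i \<omega>)" if "\<omega> \<in> chart_dom N i" "\<omega> \<notin> K" for \<omega>
  proof (rule ccontr)
    assume "\<not> \<rho> < dist x0 (chart N i \<omega>)"
    then have "chart N i \<omega> \<in> cball x0 \<rho>" by simp
    then have "chart_inv N i (chart N i \<omega>) \<in> K" unfolding K_def by blast
    then show False using ch(3)[OF that(1)] that(2) by simp
  qed
  define f where "f = (\<lambda>\<omega>. min ((dist x0 (chart N i \<omega>))\<^sup>2) (\<rho>\<^sup>2))"
  have "continuous_map (subtopology (pts N) (chart_dom N i)) euclideanreal ((\<lambda>x. min ((dist x0 x)\<^sup>2) (\<rho>\<^sup>2)) \<circ> chart N i)"
    by (rule continuous_map_compose[OF ch(6)]) (auto intro!: continuous_intros)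
  then have fc: "continuous_map (subtopology (pts N) (chart_dom N i)) euclideanreal f"
    by (simp add: f_def o_def)
  have f\<rho>: "f \<omega> = \<rho>\<^sup>2" if "\<omega> \<in> chart_dom N i" "\<omega> \<notin> K" for \<omega>
    using power_mono[OF less_imp_le[OF out[OF that]] \<rho>, of 2] by (simp add: f_def)
  show ?thesis
  proof (rule pasting_lemma[where I = UNIV and T = "\<lambda>b. if b then chart_dom N i else topspace (pts N) - K"
        and f = "\<lambda>b. if b then f else (\<lambda>_. \<rho>\<^sup>2)"])
    show "openin (pts N) (if b then chart_dom N i else topspace (pts N) - K)" for b
      using ch(1) oK by simp
    show "continuous_map (subtopology (pts N) (if b then chart_dom N i else topspace (pts N) - K))
        euclideanreal (if b then f else (\<lambda>_. \<rho>\<^sup>2))" for b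
      using fc by simp
    show "(if b then f else (\<lambda>_. \<rho>\<^sup>2)) x = (if c then f else (\<lambda>_. \<rho>\<^sup>2)) x"
      if "x \<in> topspace (pts N) \<inter> (if b then chart_dom N i else topspace (pts N) - K)
        \<inter> (if c then chart_dom N i else topspace (pts N) - K)" for b c x
      using that f\<rho> by (auto split: if_splits)
    show "\<exists>b. b \<in> UNIV \<and> x \<in> (if b then chart_dom N i else topspace (pts N) - K)
        \<and> (if x \<in> chart_dom N i then min ((dist x0 (chart N i x))\<^sup>2) (\<rho>\<^sup>2) else \<rho>\<^sup>2) = (if b then f else (\<lambda>_. \<rho>\<^sup>2)) x"
      if "x \<in> topspace (pts N)" for x
      using that Kd by (intro exI[of _ "x \<in> chart_dom N i"]) (auto simp: f_def)
  qed
qed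

theorem theorem4:
  fixes N :: "('a, 'i, 2) riem"
    and \<phi> :: "'a \<Rightarrow> real \<Rightarrow> real"
    and \<phi>b :: "real \<Rightarrow> real"
    and r0 :: real
  assumes "riemannian_manifold N"
    and "compact_space (pts N)"
    and "smooth_on_half_cylinder N \<phi>"
    and "\<And>\<omega> r. \<omega> \<in> topspace (pts N) \<Longrightarrow> 0 \<le> r \<Longrightarrow> 0 < \<phi> \<omega> r"
    and "\<phi>b differentiable_on {0..}"
    and "\<And>r. 0 \<le> r \<Longrightarrow> 0 < \<phi>b r"
    and "0 < r0"
    and "\<And>\<omega> r. \<omega> \<in> topspace (pts N) \<Longrightarrow> r0 \<le> r \<Longrightarrow> \<phi>b r \<le> \<phi> \<omega> r"
    and "\<And>r. r0 \<le> r \<Longrightarrow> 0 < deriv \<phi>b r / \<phi>b r"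
    and "\<And>\<omega> r. \<omega> \<in> topspace (pts N) \<Longrightarrow> r0 \<le> r \<Longrightarrow>
           deriv \<phi>b r / \<phi>b r \<le> deriv (\<lambda>t. \<phi> \<omega> t) r / \<phi> \<omega> r"
    and "(\<lambda>r. 1 / \<phi>b r) integrable_on {0..}"
  shows "\<forall>z\<in>topspace (pts N). regular_boundary_point N \<phi> z"
proof
  fix z assume z: "z \<in> topspace (pts N)"
  note N = assms(1) and cpt = assms(2) and sm = assms(3) and pos = assms(4) and posb = assms(6)
    and r0 = assms(7) and le = assms(8) and logle = assms(10)
  obtain i where i: "i \<in> idx N" "z \<in> chart_dom N i" using chart_cover[OF N z] .
  note ch = chart_properties[OF N i(1)]
  define U where "U = chart N i ` chart_dom N i"
  define x0 where "x0 = chart N i z"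
  have "x0 \<in> U" using i(2) by (auto simp: U_def x0_def)
  moreover have oU: "open U" using ch(2) by (simp add: U_def)
  ultimately obtain \<rho>0 where \<rho>0: "0 < \<rho>0" "cball x0 \<rho>0 \<subseteq> U" unfolding open_contains_cball by blast
  define q where "q = (\<lambda>x. (dist x0 x)\<^sup>2)"
  have q2: "Ck_on 2 U q" unfolding q_def by (rule Ck2_dist_square)
  define L where "L = laplace_beltrami (metric N i) q"
  have "continuous_on U L"
    unfolding L_def
    by (rule continuous_on_laplace_beltrami_2[OF oU _ _ q2]) (use metric_properties[OF N i(1)] in \<open>auto simp: U_def\<close>)
  then have "continuous_on (cball x0 \<rho>0) L" using \<rho>0(2) continuous_on_subset by blast
  then have "\<exists>y\<in>cball x0 \<rho>0. \<forall>x\<in>cball x0 \<rho>0. L x \<le> L y"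
    using \<rho>0(1) by (intro continuous_attains_sup) auto
  then obtain y where y: "\<And>x. x \<in> cball x0 \<rho>0 \<Longrightarrow> L x \<le> L y" by blast
  (* C exceeds the Laplacian of q on the ball, so that C * A beats it. *)
  define C where "C = \<bar>L y\<bar> + 1"
  have C: "0 < C" "\<And>x. x \<in> cball x0 \<rho>0 \<Longrightarrow> L x < C" using y unfolding C_def by force+
  obtain A A' A'' where A: "\<And>r. r0 < r \<Longrightarrow> (A has_real_derivative A' r) (at r)"
      "\<And>r. r0 < r \<Longrightarrow> (A' has_real_derivative A'' r) (at r)" "\<And>r. r0 < r \<Longrightarrow> A' r < 0"
      "\<And>r. r0 < r \<Longrightarrow> A'' r + 2 * (deriv \<phi>b r / \<phi>b r) * A' r = - 1 / (\<phi>b r)\<^sup>2"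
    and Ac: "continuous_on {r0..} A" and Ap: "\<And>r. r0 \<le> r \<Longrightarrow> 0 < A r" and Al: "(A \<longlongrightarrow> 0) at_top"
    and Am: "\<And>r s. r0 \<le> r \<Longrightarrow> r < s \<Longrightarrow> A s < A r"
    using radial_supersolution_exists[OF r0 assms(5) posb assms(9) assms(11)] by blast
  define r1 where "r1 = r0 + 1"
  (* D is the room between the values of C * A at r0 and r1, in which B and f have to fit:
     B r1 lies halfway, and f is below half of it. *)
  define D where "D = C * (A r0 - A r1)"
  have D: "0 < D" using Am[of r0 r1] C(1) by (simp add: D_def r1_def)
  define \<rho> where "\<rho> = min \<rho>0 (sqrt (D / 4))"
  have \<rho>: "0 < \<rho>" "cball x0 \<rho> \<subseteq> cball x0 \<rho>0" using \<rho>0(1) D by (auto simp: \<rho>_def)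
  have "\<rho>\<^sup>2 \<le> (sqrt (D / 4))\<^sup>2" by (rule power_mono) (use \<rho>(1) in \<open>auto simp: \<rho>_def\<close>)
  then have \<rho>2: "0 < \<rho>\<^sup>2" "\<rho>\<^sup>2 < D / 2" using D \<rho>(1) by auto
  obtain M where M: "\<And>\<omega> r. \<omega> \<in> topspace (pts N) \<Longrightarrow> 0 < r \<Longrightarrow> r \<le> r1 \<Longrightarrow> - M \<le> deriv (\<phi> \<omega>) r / \<phi> \<omega> r"
    using log_derivative_bounded_below[OF N cpt sm pos, of r1] by blast
  (* k exceeds - 2 * phi_r / phi for all r <= r1, which makes B strictly superharmonic there. *)
  define k where "k = 2 * \<bar>M\<bar> + 1"
  have k: "0 < k" by (simp add: k_def)
  define \<delta> where "\<delta> = D / 2 * exp (- k * r1)"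
  have \<delta>: "0 < \<delta>" using D by (simp add: \<delta>_def)
  define B where "B = (\<lambda>r. C * A r0 - \<delta> * exp (k * r))"
  have B1: "B r1 = C * A r1 + D / 2"
    by (simp add: B_def \<delta>_def D_def algebra_simps flip: exp_add)
  have Bmono: "B s \<le> B r" if "r \<le> s" for r s
    using \<delta> k that by (simp add: B_def)
  have B0: "B r < C * A r0" for r using \<delta> by (simp add: B_def)
  have Bpos: "0 < B r" if "r \<le> r1" for r
    using Bmono[OF that] B1 Ap[of r1] C(1) D by (smt (verit) mult_pos_pos r1_def field_sum_of_halves)
  define f where "f = (\<lambda>\<omega>. if \<omega> \<in> chart_dom N i then min (q (chart N i \<omega>)) (\<rho>\<^sup>2) else \<rho>\<^sup>2)"
  have f: "0 \<le> f \<omega>" "f \<omega> \<le> \<rho>\<^sup>2" for \<omega> by (auto simp: f_def q_def)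
  have fz: "f z = 0" using i(2) by (simp add: f_def q_def x0_def)
  have fpos: "0 < f \<omega>" if "\<omega> \<noteq> z" for \<omega>
  proof -
    have "chart N i \<omega> \<noteq> x0" if "\<omega> \<in> chart_dom N i"
      using ch(3)[OF that] ch(3)[OF i(2)] \<open>\<omega> \<noteq> z\<close> unfolding x0_def by metis
    then show ?thesis using \<rho>2(1) by (auto simp: f_def q_def)
  qed
  have fc: "continuous_map (pts N) euclideanreal f"
    unfolding f_def q_def
    by (rule truncated_square_distance_continuous[OF N i(1)]) (use \<rho> \<rho>0(2) in \<open>auto simp: U_def\<close>)
  (* Each function is frozen where the other one is the smaller: A below r0, where nothing is known
     about it, and B above r1, where it would tend to minus infinity. *)
  define outer where "outer = (\<lambda>t::ennreal. if t = top then 0 else C * A (max (enn2real t) r0))"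
  define inner where "inner = (\<lambda>t::ennreal. if t = top then B r1 else B (min (enn2real t) r1))"
  have "continuous_on {0..} (\<lambda>r. A (max r r0))"
    by (rule continuous_on_compose2[OF Ac]) (auto intro!: continuous_intros)
  moreover have "((\<lambda>r. A (max r r0)) \<longlongrightarrow> 0) at_top"
    by (rule Lim_transform_eventually[OF Al]) (auto simp: eventually_at_top_linorder max_def intro!: exI[of _ r0])
  ultimately have outer_c: "continuous_on UNIV outer"
    unfolding outer_def
    by (intro continuous_on_ennreal_extension continuous_on_mult_left tendsto_mult_right_zero)
  have inner_c: "continuous_on UNIV inner"
    unfolding inner_def
  proof (rule continuous_on_ennreal_extension)
    show "continuous_on {0..} (\<lambda>r. B (min r r1))" unfolding B_def by (intro continuous_intros)
    show "((\<lambda>r. B (min r r1)) \<longlongrightarrow> B r1) at_top"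
      by (rule tendsto_eventually) (auto simp: eventually_at_top_linorder min_def intro!: exI[of _ "r1"])
  qed
  define b where "b = (\<lambda>(\<omega>, t). min (f \<omega> + outer t) (inner t))"
  have "continuous_map (compactified N) euclideanreal (f \<circ> fst)"
    unfolding compactified_def by (rule continuous_map_compose[OF continuous_map_fst fc])
  moreover have "continuous_map (compactified N) euclideanreal (outer \<circ> snd)"
    unfolding compactified_def by (rule continuous_map_compose[OF continuous_map_snd]) (use outer_c in simp)
  moreover have "continuous_map (compactified N) euclideanreal (inner \<circ> snd)"
    unfolding compactified_def by (rule continuous_map_compose[OF continuous_map_snd]) (use inner_c in simp)
  ultimately have bc: "continuous_map (compactified N) euclideanreal b"
    unfolding b_def case_prod_unfold o_def by (intro continuous_map_real_min continuous_map_add)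
  have outer_nonneg: "0 \<le> outer t" "t \<noteq> top \<Longrightarrow> 0 < outer t" for t
    using Ap[of "max (enn2real t) r0"] C(1) by (auto simp: outer_def)
  have inner_pos: "0 < inner t" for t using Bpos by (simp add: inner_def)
  have bpos: "0 < b w" if "w \<in> topspace (compactified N) - {(z, \<infinity>)}" for w
  proof -
    obtain \<omega> t where w: "w = (\<omega>, t)" by (cases w)
    have "0 < f \<omega> + outer t"
      using that f(1)[of \<omega>] fpos[of \<omega>] outer_nonneg[of t] unfolding w
      by (cases "t = top") (auto intro: add_pos_nonneg add_nonneg_pos)
    then show ?thesis using inner_pos by (simp add: b_def w)
  qed
  have bz: "b (z, \<infinity>) = 0" using inner_pos[of top] by (simp add: b_def fz outer_def)
  define v where "v = (\<lambda>(\<omega>, r). b (\<omega>, ennreal r))"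
  have v: "v (\<omega>, r) = min (f \<omega> + C * A (max r r0)) (B (min r r1))" if "0 < r" for \<omega> r
    using that by (simp add: v_def b_def outer_def inner_def)
  let ?M = "warped_cylinder N \<phi>"
  have strip: "openin (pts ?M) (topspace (pts N) \<times> S)" if "open S" "S \<subseteq> {0<..}" for S
    using that by (simp add: openin_prod_Times_iff openin_open_eq)
  have super: "superharmonic ?M v"
  proof (rule superharmonicI_touching[OF N sm pos])
    have "continuous_map (pts ?M) (compactified N) (\<lambda>w. (fst w, ennreal (snd w)))"
      unfolding warped_cylinder_simps compactified_def
      by (intro continuous_map_pairedI continuous_map_fst
          continuous_map_compose[OF continuous_map_snd, where g = ennreal, unfolded o_def])
        (auto intro!: continuous_on_ennreal continuous_on_id)
    from continuous_map_compose[OF this bc] show "continuous_map (pts ?M) euclideanreal v"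
      by (simp add: v_def o_def case_prod_unfold)
    fix \<omega>0 s assume w0: "\<omega>0 \<in> topspace (pts N)" and s: "0 < (s::real)"
    have p0: "0 < \<phi> \<omega>0 s" using pos w0 s by simp
    obtain j where j: "j \<in> idx N" "\<omega>0 \<in> chart_dom N j" using chart_cover[OF N w0] .
    show "touched_by_strict_supersolution N \<phi> v \<omega>0 s"
    proof (cases "B (min s r1) \<le> f \<omega>0 + C * A (max s r0)")
      case True
      (* For s >= r1, where B is frozen at B r1, the outer function is below B r1. *)
      have s1: "s < r1"
      proof (rule ccontr)
        assume "\<not> s < r1"
        then have "A (max s r0) \<le> A r1" using Am[of r1 s] by (cases "s = r1") (auto simp: r1_def max_def)
        then have "C * A (max s r0) \<le> C * A r1" using C(1) by simp
        then show False using True B1 f(2)[of \<omega>0] \<rho>2(2) \<open>\<not> s < r1\<close> by (simp add: min_def split: if_splits)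
      qed
      have B': "(B has_real_derivative - \<delta> * k * exp (k * r)) (at r)"
        "((\<lambda>r. - \<delta> * k * exp (k * r)) has_real_derivative - \<delta> * k\<^sup>2 * exp (k * r)) (at r)" for r
        unfolding B_def by (auto intro!: derivative_eq_intros simp: power2_eq_square)
      have "0 < k + 2 * (deriv (\<phi> \<omega>0) s / \<phi> \<omega>0 s)"
        using M[OF w0 s] s1 unfolding k_def by linarith
      then have "0 < \<delta> * k * exp (k * s) * (k + 2 * (deriv (\<phi> \<omega>0) s / \<phi> \<omega>0 s))"
        using \<delta> k by simp
      then have neg: "- \<delta> * k\<^sup>2 * exp (k * s) + 2 * (deriv (\<phi> \<omega>0) s / \<phi> \<omega>0 s) * (- \<delta> * k * exp (k * s)) < 0"
        by (simp add: algebra_simps power2_eq_square)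
      have neg': "- \<delta> * k\<^sup>2 * exp (k * s) + 2 * (deriv (\<phi> \<omega>0) s / \<phi> \<omega>0 s) * (- \<delta> * k * exp (k * s))
          + laplace_beltrami (metric N j) (\<lambda>_. 0) (chart N j \<omega>0) / (\<phi> \<omega>0 s)\<^sup>2 < 0"
        using neg by (simp add: laplace_beltrami_const)
      show ?thesis
      proof (rule touched_by_strict_supersolutionI[where N = N and \<phi> = \<phi> and q = "\<lambda>_. 0" and a = B
            and a' = "\<lambda>r. - \<delta> * k * exp (k * r)" and T = "topspace (pts N) \<times> {0<..<r1}",
            OF j Ck2_const _ B'(2)[of s] _ _ _ _ neg'])
        show "\<forall>\<^sub>F r in nhds s. (B has_real_derivative - \<delta> * k * exp (k * r)) (at r)"
          by (rule always_eventually) (use B'(1) in blast)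
        show "openin (pts ?M) (topspace (pts N) \<times> {0<..<r1})" by (rule strip) auto
        show "(\<omega>0, s) \<in> topspace (pts N) \<times> {0<..<r1}" using w0 s s1 by simp
        show "v (\<omega>, r) \<le> 0 + B r" if "(\<omega>, r) \<in> topspace (pts N) \<times> {0<..<r1}" for \<omega> r
          using v[of r \<omega>] that by simp
        show "v (\<omega>0, s) = 0 + B s" using v[OF s] True s1 by simp
      qed
    next
      case False
      (* For s <= r0, where A is frozen at A r0, the outer function is above every value of B. *)
      have s0: "r0 < s"
      proof (rule ccontr)
        assume "\<not> r0 < s"
        then show False using False B0[of "min s r1"] f(1)[of \<omega>0] by (simp add: max_def)
      qed
      have vs: "v (\<omega>0, s) = f \<omega>0 + C * A s" using v[OF s, of \<omega>0] False s0 by simp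
      have vle: "v (\<omega>, r) \<le> f \<omega> + C * A r" if "r0 < r" for \<omega> r using v[of r \<omega>] that r0 by simp
      have A1: "\<forall>\<^sub>F r in nhds s. ((\<lambda>r. C * A r) has_real_derivative C * A' r) (at r)"
        using eventually_nhds_in_open[of "{r0<..}" s] s0
        by (auto elim!: eventually_mono intro!: DERIV_cmult A(1))
      have A2: "((\<lambda>r. C * A' r) has_real_derivative C * A'' s) (at s)"
        by (rule DERIV_cmult[OF A(2)[OF s0]])
      have rad: "C * A'' s + 2 * (deriv (\<phi> \<omega>0) s / \<phi> \<omega>0 s) * (C * A' s) \<le> - C / (\<phi> \<omega>0 s)\<^sup>2"
      proof -
        have "deriv (\<phi> \<omega>0) s / \<phi> \<omega>0 s * A' s \<le> deriv \<phi>b s / \<phi>b s * A' s"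
          by (rule mult_right_mono_neg) (use logle[OF w0] A(3)[OF s0] s0 in auto)
        then have "A'' s + 2 * (deriv (\<phi> \<omega>0) s / \<phi> \<omega>0 s) * A' s \<le> - 1 / (\<phi>b s)\<^sup>2"
          using A(4)[OF s0] by simp
        also have "\<dots> \<le> - 1 / (\<phi> \<omega>0 s)\<^sup>2"
        proof -
          have "0 < \<phi>b s" "\<phi>b s \<le> \<phi> \<omega>0 s" using posb[of s] le[OF w0] s s0 by auto
          then have "(\<phi>b s)\<^sup>2 \<le> (\<phi> \<omega>0 s)\<^sup>2" by (intro power_mono) auto
          then have "1 / (\<phi> \<omega>0 s)\<^sup>2 \<le> 1 / (\<phi>b s)\<^sup>2" using \<open>0 < \<phi>b s\<close> p0 by (intro divide_left_mono) auto
          then show ?thesis by simp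
        qed
        finally have "C * (A'' s + 2 * (deriv (\<phi> \<omega>0) s / \<phi> \<omega>0 s) * A' s) \<le> C * (- 1 / (\<phi> \<omega>0 s)\<^sup>2)"
          using C(1) by (rule mult_left_mono[OF _ less_imp_le])
        then show ?thesis by (simp add: algebra_simps)
      qed
      have neg: "C * A'' s + 2 * (deriv (\<phi> \<omega>0) s / \<phi> \<omega>0 s) * (C * A' s) + l / (\<phi> \<omega>0 s)\<^sup>2 < 0" if "l < C" for l
      proof -
        have "l / (\<phi> \<omega>0 s)\<^sup>2 < C / (\<phi> \<omega>0 s)\<^sup>2" using that p0 by (simp add: divide_strict_right_mono)
        then show ?thesis using rad by simp
      qed
      have o: "openin (pts ?M) (topspace (pts N) \<times> {r0<..})" by (rule strip) (use r0 in auto)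
      have in_o: "(\<omega>0, s) \<in> topspace (pts N) \<times> {r0<..}" using w0 s0 by simp
      show ?thesis
      proof (cases "\<omega>0 \<in> chart_dom N i \<and> q (chart N i \<omega>0) \<le> \<rho>\<^sup>2")
        case True
        have "chart N i \<omega>0 \<in> cball x0 \<rho>"
          using True \<rho>(1) by (auto simp: q_def intro: power2_le_imp_le)
        then have "L (chart N i \<omega>0) < C" using C(2) \<rho>(2) by blast
        then have neg': "C * A'' s + 2 * (deriv (\<phi> \<omega>0) s / \<phi> \<omega>0 s) * (C * A' s)
            + laplace_beltrami (metric N i) q (chart N i \<omega>0) / (\<phi> \<omega>0 s)\<^sup>2 < 0"
          unfolding L_def by (rule neg)
        show ?thesis
        proof (rule touched_by_strict_supersolutionI[where N = N and \<phi> = \<phi> and q = q and a = "\<lambda>r. C * A r"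
              and a' = "\<lambda>r. C * A' r", OF i(1) _ q2[unfolded U_def] A1 A2 o in_o _ _ neg'])
          show "\<omega>0 \<in> chart_dom N i" using True by blast
          show "v (\<omega>, r) \<le> q (chart N i \<omega>) + C * A r"
            if "(\<omega>, r) \<in> topspace (pts N) \<times> {r0<..}" "\<omega> \<in> chart_dom N i" for \<omega> r
            using vle[of r \<omega>] that by (simp add: f_def)
          show "v (\<omega>0, s) = q (chart N i \<omega>0) + C * A s" using vs True by (simp add: f_def)
        qed
      next
        case False
        then have fr: "f \<omega>0 = \<rho>\<^sup>2" by (auto simp: f_def)
        have neg': "C * A'' s + 2 * (deriv (\<phi> \<omega>0) s / \<phi> \<omega>0 s) * (C * A' s)
            + laplace_beltrami (metric N j) (\<lambda>_. \<rho>\<^sup>2) (chart N j \<omega>0) / (\<phi> \<omega>0 s)\<^sup>2 < 0"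
          unfolding laplace_beltrami_const by (rule neg) (rule C(1))
        show ?thesis
        proof (rule touched_by_strict_supersolutionI[where N = N and \<phi> = \<phi> and q = "\<lambda>_. \<rho>\<^sup>2" and a = "\<lambda>r. C * A r"
              and a' = "\<lambda>r. C * A' r", OF j Ck2_const A1 A2 o in_o _ _ neg'])
          show "v (\<omega>, r) \<le> \<rho>\<^sup>2 + C * A r" if "(\<omega>, r) \<in> topspace (pts N) \<times> {r0<..}" for \<omega> r
            using vle[of r \<omega>] f(2)[of \<omega>] that by force
          show "v (\<omega>0, s) = \<rho>\<^sup>2 + C * A s" using vs fr by simp
        qed
      qed
    qed
  qed
  have "barrier N \<phi> z b"
    unfolding barrier_def
  proof (intro conjI ballI bc bz bpos)
    show "0 \<le> b w" if "w \<in> topspace (compactified N)" for w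
      using bpos[of w] bz that by (cases "w = (z, \<infinity>)") (auto simp: less_imp_le)
    show "superharmonic ?M (\<lambda>(\<omega>, r). b (\<omega>, ennreal r))" using super by (simp add: v_def)
  qed
  then show "regular_boundary_point N \<phi> z" using z unfolding regular_boundary_point_def by blast
qed

end
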